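(* Let $A$ be a $C^*$-algebra, let $I$ be a closed two-sided ideal of $A$, and let $a_1,\ldots,a_n\in A$ be pairwise commuting elements. Then: (i) For every $\epsilon>0$ there is $e\in I$ such that $1+e$ is invertible and, for all $j=1,\ldots,n$, $$\|(1+e)a_j(1+e)^{-1}\|-\epsilon\;\le\;\max\{r(a_j),\|\dot a_j\|\}\;\le\;\|(1+e)a_j(1+e)^{-1}\|.$$ (ii) If $r(a_j)<\|\dot a_j\|$ for all $j=1,\ldots,n$, then there is $e\in I$ such that $1+e$ is invertible and, for all $j=1,\ldots,n$, $$\max\{r(a_j),\|\dot a_j\|\}=\|(1+e)a_j(1+e)^{-1}\|.$$
   Context: $r(x)$ denotes the spectral radius of $x\in A$, and $\dot x$ denotes the image of $x\in A$ under the canonical surjection $A\to A/I$; $\|\dot x\|$ is its norm in the quotient $C^*$-algebra $A/I$. The symbol $1$ denotes the unit of $A$ (or of the unitization of $A$ if $A$ is not unital), and invertibility of $1+e$ is understood there. The elements $a_j$ are not assumed normal. *)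

theory Defs
  imports "HOL-Analysis.Analysis" "HOL-Algebra.Group"
begin

text \<open>
  Complex \<open>C\<^sup>*\<close>-algebras, not assumed unital. The underlying real Banach algebra is the
  library's; \<open>scaleC_of_real\<close> ties the complex scalar multiplication to it.
\<close>

class cstar_algebra = real_normed_algebra + banach +
  fixes scaleC :: "complex \<Rightarrow> 'a \<Rightarrow> 'a" (infixr "*\<^sub>C" 75)
    and star :: "'a \<Rightarrow> 'a"
  assumes scaleC_add_right: "c *\<^sub>C (x + y) = c *\<^sub>C x + c *\<^sub>C y"
    and scaleC_add_left: "(c + d) *\<^sub>C x = c *\<^sub>C x + d *\<^sub>C x"
    and scaleC_scaleC: "c *\<^sub>C (d *\<^sub>C x) = (c * d) *\<^sub>C x"
    and scaleC_of_real: "complex_of_real t *\<^sub>C x = t *\<^sub>R x"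
    and mult_scaleC_left: "(c *\<^sub>C x) * y = c *\<^sub>C (x * y)"
    and mult_scaleC_right: "x * (c *\<^sub>C y) = c *\<^sub>C (x * y)"
    and norm_scaleC: "norm (c *\<^sub>C x) = cmod c * norm x"
    and star_add: "star (x + y) = star x + star y"
    and star_scaleC: "star (c *\<^sub>C x) = cnj c *\<^sub>C star x"
    and star_mult: "star (x * y) = star y * star x"
    and star_star: "star (star x) = x"
    and cstar_identity: "norm (star x * x) = (norm x)\<^sup>2"

definition identity_element :: "'a::times \<Rightarrow> bool" where
  "identity_element u \<longleftrightarrow> (\<forall>x. u * x = x \<and> x * u = x)"

definition unital :: "'a::times itself \<Rightarrow> bool" where
  "unital _ \<longleftrightarrow> (\<exists>u::'a. identity_element u)"

text \<open>
  The algebra \<open>A\<close> itself if it is unital, and its unitization \<open>A \<oplus> \<complex>\<close> otherwise, as a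
  multiplicative monoid. Both are realised inside \<open>A \<times> \<complex>\<close>, where \<open>(a, s)\<close> stands for
  \<open>a + s 1\<close> and \<open>A\<close> is identified with \<open>A \<times> {0}\<close>; in the unital case the carrier is just
  \<open>A \<times> {0}\<close> and no new unit is adjoined. Addition is that of the product type.
\<close>

definition unitization :: "('a::cstar_algebra \<times> complex) monoid" where
  "unitization =
    \<lparr>carrier = (if unital TYPE('a) then UNIV \<times> {0} else UNIV),
     mult = (\<lambda>(a, s) (b, t). (a * b + s *\<^sub>C b + t *\<^sub>C a, s * t)),
     one = (if unital TYPE('a) then (THE u. identity_element u, 0) else (0, 1))\<rparr>"

definition unitization_scaleC :: "complex \<Rightarrow> 'a::cstar_algebra \<times> complex \<Rightarrow> 'a \<times> complex" where
  "unitization_scaleC c = (\<lambda>(a, s). (c *\<^sub>C a, c * s))"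

definition embed :: "'a::cstar_algebra \<Rightarrow> 'a \<times> complex" where
  "embed a = (a, 0)"

text \<open>
  If \<open>A\<close> is not unital, the \<open>C\<^sup>*\<close>-norm of \<open>a + s 1\<close> is the operator norm of the left
  multiplication \<open>x \<mapsto> a x + s x\<close> on \<open>A\<close>.
\<close>

definition unitization_norm :: "'a::cstar_algebra \<times> complex \<Rightarrow> real" where
  "unitization_norm = (\<lambda>(a, s).
    if unital TYPE('a) then norm a
    else (SUP x\<in>cball 0 1. norm (a * x + s *\<^sub>C x)))"

definition spectrum :: "'a::cstar_algebra \<Rightarrow> complex set" where
  "spectrum x =
    {c. embed x - unitization_scaleC c \<one>\<^bsub>unitization\<^esub> \<notin> Units unitization}"

text \<open>
  The spectrum is nonempty unless \<open>A = {0}\<close>, and inserting \<open>0\<close> only serves to make the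
  spectral radius \<open>0\<close> in that case, since the supremum of the empty set of reals is unspecified.
\<close>

definition spectral_radius :: "'a::cstar_algebra \<Rightarrow> real" where
  "spectral_radius x = Sup (insert 0 (cmod ` spectrum x))"

definition closed_two_sided_ideal :: "'a::cstar_algebra set \<Rightarrow> bool" where
  "closed_two_sided_ideal I \<longleftrightarrow>
    closed I \<and> 0 \<in> I \<and> (\<forall>x\<in>I. \<forall>y\<in>I. x + y \<in> I) \<and> (\<forall>c. \<forall>x\<in>I. c *\<^sub>C x \<in> I) \<and>
    (\<forall>a. \<forall>x\<in>I. a * x \<in> I \<and> x * a \<in> I)"

text \<open>
  Elements of \<open>A/I\<close> are the cosets \<open>x + I\<close>; the quotient norm of a coset is the infimum of
  the norms of its elements.
\<close>

definition ideal_coset :: "'a::cstar_algebra set \<Rightarrow> 'a \<Rightarrow> 'a set" where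
  "ideal_coset I x = (\<lambda>y. x + y) ` I"

definition quotient_norm :: "'a::cstar_algebra set \<Rightarrow> real" where
  "quotient_norm X = (INF z\<in>X. norm z)"

definition one_plus :: "'a::cstar_algebra \<Rightarrow> 'a \<times> complex" where
  "one_plus e = \<one>\<^bsub>unitization\<^esub> + embed e"

definition conjugate_by :: "'a::cstar_algebra \<Rightarrow> 'a \<Rightarrow> 'a \<times> complex" where
  "conjugate_by e x =
    one_plus e \<otimes>\<^bsub>unitization\<^esub> embed x \<otimes>\<^bsub>unitization\<^esub> inv\<^bsub>unitization\<^esub> (one_plus e)"

end

theory Submission
  imports Defs
begin

text \<open>
  Since \<open>(1 + e) a (1 + e)\<^sup>-\<^sup>1\<close> lies in \<open>a + I\<close> and is similar to \<open>a\<close>, its norm dominates both the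
  quotient norm and the spectral radius of \<open>a\<close> (\<open>conjugate_lower_bound\<close>). Everything else is the
  opposite estimate, and for it both parts reduce to one statement about commuting \<open>b\<^sub>1, \<dots>, b\<^sub>n\<close>: if
  \<open>r(b\<^sub>j) < 1\<close> and \<open>b\<^sub>j\<close> has quotient norm at most \<open>1\<close>, then a single \<open>1 + e\<close> makes all the conjugates
  contractions (\<open>simultaneous_conjugation\<close>). With \<open>M\<^sub>j\<close> the larger of spectral
  radius and quotient norm of \<open>a\<^sub>j\<close>, part (i) applies this to \<open>a\<^sub>j / (M\<^sub>j + \<epsilon>)\<close>. In part (ii) the quotient norm exceeds the spectral radius
  strictly, so that \<open>a\<^sub>j\<close> may be divided by its quotient norm itself.

  To find \<open>e\<close>, look for \<open>p \<ge> 0\<close> in \<open>I\<close> and let \<open>1 + e\<close> be a self-adjoint square root of \<open>s = 1 + p\<close>. The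
  conjugate of \<open>b\<close> is then a contraction as soon as \<open>b\<^sup>* s b \<le> s\<close> (\<open>norm_conjugate_le_one\<close>). The bound on
  the quotient norm provides \<open>f \<ge> 0\<close> in \<open>I\<close> with \<open>b\<^sub>j\<^sup>* b\<^sub>j \<le> 1 + f\<close> for all \<open>j\<close>: the sum of the positive
  parts of the \<open>b\<^sub>j\<^sup>* b\<^sub>j - 1\<close>, each of which lies in \<open>I\<close> (\<open>ideal_excess\<close>). So it suffices that
  \<open>b\<^sub>j\<^sup>* p b\<^sub>j + f \<le> p\<close> for all \<open>j\<close>. For a single \<open>b\<close> the series \<open>p = \<Sum>n. (b\<^sup>n)\<^sup>* f b\<^sup>n\<close> does this. For
  several, apply the maps \<open>T\<^sub>j y = \<Sum>n. (b\<^sub>j\<^sup>n)\<^sup>* y b\<^sub>j\<^sup>n\<close> to \<open>f\<close> one after another: each is positive, dominates the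
  identity and, because the \<open>b\<^sub>i\<close> commute, commutes with \<open>y \<mapsto> b\<^sub>i\<^sup>* y b\<^sub>i\<close>, so that inequalities already
  achieved survive (\<open>simultaneous_stein_inequality\<close>).

  The series converge by the spectral radius hypothesis. This is the analytic content of Gelfand's
  formula; it is obtained by averaging the resolvent of \<open>b\<close> over roots of unity, which gives the
  resolvent of \<open>b\<^sup>n\<close> with bounds that do not depend on \<open>n\<close> (\<open>power_series_radius\<close>).

  The order theory is built on the norm alone, with positivity of a self-adjoint \<open>a\<close> meaning
  \<open>\<parallel>t - a\<parallel> \<le> t\<close> for some \<open>t\<close>. Square roots come from the binomial series of \<open>\<surd>(1 - x)\<close>, which converges on the whole
  closed unit ball, and the places where one would usually look at spectra are handled by bounding
  the growth of powers of self-adjoint elements (\<open>norm_le_one_of_power_growth\<close>). This leads to Kaplansky's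
  theorem that \<open>y\<^sup>* y\<close> is positive (\<open>positive_star_mult_self\<close>).

  All of this happens in \<open>A \<oplus> \<complex>\<close>, with a unit adjoined even if \<open>A\<close> has one. That is harmless: whether \<open>1 + e\<close>
  is invertible, and what its conjugates of elements of \<open>A\<close> are, can be said by quasi-inverses inside \<open>A\<close>,
  whichever unit is meant.
\<close>

section \<open>Involution and complex scalars in a \<open>C\<^sup>*\<close>-algebra\<close>

class unital_cstar_algebra = cstar_algebra + real_normed_algebra_1

lemma star_zero [simp]: "star (0::'a::cstar_algebra) = 0"
  using star_add[of "0::'a" 0] by simp

lemma star_minus [simp]: "star (- x) = - star (x::'a::cstar_algebra)"
  using star_add[of x "-x"] by (simp add: eq_neg_iff_add_eq_0 add.commute)

lemma star_diff: "star (x - y) = star x - star (y::'a::cstar_algebra)"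
  using star_add[of x "-y"] by simp

lemma star_scaleR: "star (r *\<^sub>R x) = r *\<^sub>R star (x::'a::cstar_algebra)"
  by (metis scaleC_of_real star_scaleC complex_cnj_complex_of_real)

lemma star_one [simp]: "star (1::'a::unital_cstar_algebra) = 1"
  by (metis mult_1 mult.right_neutral star_mult star_star)

lemma star_power: "star (x ^ n) = star (x::'a::unital_cstar_algebra) ^ n"
  by (induction n) (simp_all add: star_mult power_commutes)

lemmas star_simps = star_add star_diff star_scaleR star_scaleC star_mult star_star

lemma norm_star [simp]: "norm (star x) = norm (x::'a::cstar_algebra)"
proof -
  have le: "norm y \<le> norm (star y)" for y :: 'a
  proof (cases "norm y = 0")
    case False
    have "norm y * norm y \<le> norm (star y) * norm y"
      using norm_mult_ineq[of "star y" y] by (simp add: cstar_identity power2_eq_square)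
    with False show ?thesis by simp
  qed simp
  show ?thesis using le[of x] le[of "star x"] by (simp add: star_star)
qed

lemma bounded_linear_star: "bounded_linear (star :: 'a::cstar_algebra \<Rightarrow> 'a)"
  by (rule bounded_linear_intro[where K = 1]) (simp_all add: star_simps)

lemmas tendsto_star = bounded_linear.tendsto[OF bounded_linear_star]

lemma scaleC_one [simp]: "1 *\<^sub>C x = (x::'a::cstar_algebra)"
  using scaleC_of_real[of 1 x] by simp

lemma scaleC_minus_one: "(-1) *\<^sub>C x = - (x::'a::cstar_algebra)"
  using scaleC_of_real[of "-1" x] by simp

lemma scaleC_zero_right [simp]: "c *\<^sub>C 0 = (0::'a::cstar_algebra)"
  using scaleC_add_right[of c "0::'a" 0] by simp

lemma scaleC_zero_left [simp]: "0 *\<^sub>C x = (0::'a::cstar_algebra)"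
  using scaleC_add_left[of 0 0 x] by simp

lemma scaleC_minus_right [simp]: "c *\<^sub>C (- x) = - (c *\<^sub>C (x::'a::cstar_algebra))"
  using scaleC_add_right[of c x "-x"] by (simp add: eq_neg_iff_add_eq_0 add.commute)

lemma scaleC_minus_left [simp]: "(- c) *\<^sub>C x = - (c *\<^sub>C (x::'a::cstar_algebra))"
  using scaleC_add_left[of c "-c" x] by (simp add: eq_neg_iff_add_eq_0 add.commute)

lemma scaleC_diff_right: "c *\<^sub>C (x - y) = c *\<^sub>C x - c *\<^sub>C (y::'a::cstar_algebra)"
  using scaleC_add_right[of c x "-y"] by simp

lemma scaleC_diff_left: "(c - d) *\<^sub>C x = c *\<^sub>C x - d *\<^sub>C (x::'a::cstar_algebra)"
  using scaleC_add_left[of c "-d" x] by simp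

lemma scaleC_sum_left: "(sum f S) *\<^sub>C x = (\<Sum>i\<in>S. f i *\<^sub>C (x :: 'a::cstar_algebra))"
  by (induction S rule: infinite_finite_induct) (simp_all add: scaleC_add_left)

lemma power_scaleC: "(c *\<^sub>C x) ^ n = c ^ n *\<^sub>C (x::'a::unital_cstar_algebra) ^ n"
  by (induction n) (simp_all add: mult_scaleC_left mult_scaleC_right scaleC_scaleC mult.commute)

lemma cstar_square: "star x = x \<Longrightarrow> norm (x * x) = (norm (x::'a::cstar_algebra))\<^sup>2"
  using cstar_identity[of x] by simp

section \<open>Square roots by the binomial series\<close>

text \<open>
  The power series coefficients of \<open>\<surd>(1 - x)\<close>.
\<close>

definition sqrt_coeff :: "nat \<Rightarrow> real" where
  "sqrt_coeff k = (-1) ^ k * ((1/2) gchoose k)"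

lemma sqrt_coeff_0 [simp]: "sqrt_coeff 0 = 1"
  by (simp add: sqrt_coeff_def)

text \<open>
  Partial sums of alternating binomial coefficients are again binomial coefficients, here the positive
  Taylor coefficients of \<open>1 / \<surd>(1 - x)\<close>. As all coefficients but the first are nonpositive, this bounds
  the sum of the absolute values of these others by \<open>1\<close>, which is why the series may be used on the closed unit ball.
\<close>

lemma sqrt_coeff_partial_sum_nonneg: "0 \<le> (\<Sum>k\<le>m. sqrt_coeff k)"
proof -
  have rec: "((-1) ^ m * ((-1/2::real) gchoose m)) \<ge> 0" for m
  proof (induction m)
    case (Suc m)
    have "(-1) ^ Suc m * ((-1/2::real) gchoose Suc m)
        = ((-1) ^ m * ((-1/2) gchoose m)) * ((real m + 1/2) / (real m + 1))"
      by (simp add: gbinomial_prod_rev field_simps)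
    then show ?case using Suc by simp
  qed simp
  have "(\<Sum>k\<le>m. sqrt_coeff k) = (-1) ^ m * ((1/2 - 1 :: real) gchoose m)"
    unfolding sqrt_coeff_def
    by (subst gbinomial_sum_lower_neg[symmetric]) (simp add: mult.commute)
  then show ?thesis using rec[of m] by simp
qed

lemma sqrt_coeff_Suc_nonpos: "sqrt_coeff (Suc k) \<le> 0"
proof -
  have *: "sqrt_coeff (Suc k) = sqrt_coeff k * ((real k - 1/2) / (real k + 1))" for k
    by (simp add: sqrt_coeff_def gbinomial_prod_rev field_simps)
  show ?thesis
  proof (induction k)
    case 0
    show ?case by (simp add: *)
  next
    case (Suc k)
    then show ?case unfolding *[of "Suc k"]
      by (intro mult_nonpos_nonneg) auto
  qed
qed

text \<open>
  Vandermonde's identity: the Cauchy square of the series is \<open>(1 - x)\<^sup>1\<close>.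
\<close>

lemma sqrt_coeff_convolution:
  "(\<Sum>i\<le>k. sqrt_coeff i * sqrt_coeff (k - i)) = (if k = 0 then 1 else if k = 1 then -1 else 0)"
proof -
  have "(\<Sum>i\<le>k. sqrt_coeff i * sqrt_coeff (k - i))
      = (-1) ^ k * (\<Sum>i\<le>k. ((1/2::real) gchoose i) * ((1/2) gchoose (k - i)))"
    unfolding sum_distrib_left
    by (intro sum.cong refl) (simp add: sqrt_coeff_def flip: power_add)
  also have "(\<Sum>i\<le>k. ((1/2::real) gchoose i) * ((1/2) gchoose (k - i))) = (1 gchoose k)"
    using gbinomial_Vandermonde[of "1/2::real" "1/2" k] by (simp add: atMost_atLeast0)
  also have "(1 gchoose k) = real (1 choose k)"
    using binomial_gbinomial[of 1 k, where ?'a = real] by simp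
  also have "(-1) ^ k * real (1 choose k) = (if k = 0 then 1 else if k = 1 then -1 else 0)"
    by (cases k rule: nat.exhaust) (auto simp: binomial_eq_0)
  finally show ?thesis .
qed

lemma sqrt_coeff_tail:
  "summable (\<lambda>k. \<bar>sqrt_coeff (Suc k)\<bar>)" "(\<Sum>k. \<bar>sqrt_coeff (Suc k)\<bar>) \<le> 1"
proof -
  have "(\<Sum>k<m. \<bar>sqrt_coeff (Suc k)\<bar>) \<le> 1" for m
  proof -
    have "(\<Sum>k<m. \<bar>sqrt_coeff (Suc k)\<bar>) = (\<Sum>k<m. - sqrt_coeff (Suc k))"
      by (intro sum.cong refl abs_of_nonpos sqrt_coeff_Suc_nonpos)
    also have "\<dots> = 1 - (\<Sum>k\<le>m. sqrt_coeff k)"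
      by (simp add: sum.atMost_shift sum_negf)
    finally show ?thesis using sqrt_coeff_partial_sum_nonneg[of m] by simp
  qed
  then show "summable (\<lambda>k. \<bar>sqrt_coeff (Suc k)\<bar>)" "(\<Sum>k. \<bar>sqrt_coeff (Suc k)\<bar>) \<le> 1"
    by (auto intro!: summableI_nonneg_bounded suminf_le_const)
qed

definition sqrt_one_minus :: "'a::unital_cstar_algebra \<Rightarrow> 'a" where
  "sqrt_one_minus x = (\<Sum>k. sqrt_coeff k *\<^sub>R x ^ k)"

text \<open>
  Square roots are located by means of such sets: the commutant of an element, and the preimage of
  a closed ideal under the projection of \<open>A \<oplus> \<complex>\<close> to \<open>A\<close>.
\<close>

definition closed_subalgebra :: "'a::unital_cstar_algebra set \<Rightarrow> bool" where
  "closed_subalgebra S \<longleftrightarrow> closed S \<and> 1 \<in> S \<and> (\<forall>x\<in>S. \<forall>y\<in>S. x + y \<in> S \<and> x * y \<in> S) \<and>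
    (\<forall>r. \<forall>x\<in>S. r *\<^sub>R x \<in> S)"

lemma closed_subalgebra_commutant:
  "closed_subalgebra {x::'a::unital_cstar_algebra. x * y = y * x}"
proof -
  have "closed {x. x * y = y * x}"
    by (intro closed_Collect_eq continuous_intros)
  then show ?thesis
    by (auto simp: closed_subalgebra_def distrib_left distrib_right mult.assoc)
      (metis mult.assoc)
qed

context
  fixes x :: "'a::unital_cstar_algebra"
  assumes x: "norm x \<le> 1"
begin

lemma sqrt_one_minus_summable_norm: "summable (\<lambda>k. norm (sqrt_coeff k *\<^sub>R x ^ k))"
proof (subst summable_Suc_iff[symmetric], rule summable_comparison_test')
  show "norm (norm (sqrt_coeff (Suc k) *\<^sub>R x ^ Suc k)) \<le> \<bar>sqrt_coeff (Suc k)\<bar>" for k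
    using norm_power_ineq[of x "Suc k"] power_le_one[OF norm_ge_zero x, of "Suc k"]
    by (simp del: power_Suc add: mult_left_le)
qed (rule sqrt_coeff_tail(1))

lemma sqrt_one_minus_sums: "(\<lambda>k. sqrt_coeff k *\<^sub>R x ^ k) sums sqrt_one_minus x"
  unfolding sqrt_one_minus_def
  by (rule summable_sums[OF summable_norm_cancel[OF sqrt_one_minus_summable_norm]])

lemma sqrt_one_minus_square: "sqrt_one_minus x * sqrt_one_minus x = 1 - x"
proof -
  let ?c = "\<lambda>k. if k = 0 then 1 else if k = 1 then - 1 else (0::real)"
  have "(\<lambda>k. \<Sum>i\<le>k. (sqrt_coeff i *\<^sub>R x ^ i) * (sqrt_coeff (k - i) *\<^sub>R x ^ (k - i)))
      sums (sqrt_one_minus x * sqrt_one_minus x)"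
    unfolding sqrt_one_minus_def
    by (intro Cauchy_product_sums sqrt_one_minus_summable_norm)
  moreover have "(\<Sum>i\<le>k. (sqrt_coeff i *\<^sub>R x ^ i) * (sqrt_coeff (k - i) *\<^sub>R x ^ (k - i)))
      = ?c k *\<^sub>R x ^ k" for k
  proof -
    have "(\<Sum>i\<le>k. (sqrt_coeff i *\<^sub>R x ^ i) * (sqrt_coeff (k - i) *\<^sub>R x ^ (k - i)))
        = (\<Sum>i\<le>k. sqrt_coeff i * sqrt_coeff (k - i)) *\<^sub>R x ^ k"
      unfolding scaleR_sum_left by (intro sum.cong refl) (simp flip: power_add)
    then show ?thesis unfolding sqrt_coeff_convolution .
  qed
  ultimately have "(\<lambda>k. ?c k *\<^sub>R x ^ k) sums (sqrt_one_minus x * sqrt_one_minus x)"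
    by simp
  moreover have "(\<lambda>k. ?c k *\<^sub>R x ^ k) sums (\<Sum>k\<in>{0,1}. ?c k *\<^sub>R x ^ k)"
    by (rule sums_finite) auto
  ultimately show ?thesis by (simp add: sums_unique2)
qed

lemma norm_one_minus_sqrt_one_minus: "norm (1 - sqrt_one_minus x) \<le> 1"
proof -
  have "(\<lambda>k. sqrt_coeff (Suc k) *\<^sub>R x ^ Suc k) sums (sqrt_one_minus x - 1)"
    using sqrt_one_minus_sums by (subst sums_Suc_iff) simp
  then have eq: "sqrt_one_minus x - 1 = (\<Sum>k. sqrt_coeff (Suc k) *\<^sub>R x ^ Suc k)"
    by (rule sums_unique)
  have "norm (sqrt_one_minus x - 1) \<le> (\<Sum>k. \<bar>sqrt_coeff (Suc k)\<bar>)"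
    unfolding eq
  proof (rule norm_suminf_le)
    show "norm (sqrt_coeff (Suc k) *\<^sub>R x ^ Suc k) \<le> \<bar>sqrt_coeff (Suc k)\<bar>" for k
      using norm_power_ineq[of x "Suc k"] power_le_one[OF norm_ge_zero x, of "Suc k"]
      by (simp del: power_Suc add: mult_left_le)
  qed (rule sqrt_coeff_tail(1))
  then show ?thesis using sqrt_coeff_tail(2) by (simp add: norm_minus_commute)
qed

lemma star_sqrt_one_minus: "star x = x \<Longrightarrow> star (sqrt_one_minus x) = sqrt_one_minus x"
  using bounded_linear.sums[OF bounded_linear_star sqrt_one_minus_sums] sqrt_one_minus_sums
  by (simp add: star_scaleR star_power sums_unique2)

lemma sqrt_one_minus_mem:
  assumes S: "closed_subalgebra S" "x \<in> S"
  shows "sqrt_one_minus x \<in> S"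
proof -
  have pow: "x ^ k \<in> S" for k
    using S by (induction k) (auto simp: closed_subalgebra_def)
  have "0 \<in> S" using S by (metis closed_subalgebra_def scaleR_zero_left)
  then have "(\<Sum>k<m. sqrt_coeff k *\<^sub>R x ^ k) \<in> S" for m
    using S pow by (induction m) (auto simp: closed_subalgebra_def)
  then show ?thesis
    using sqrt_one_minus_sums S(1) unfolding sums_def closed_subalgebra_def
    by (meson closed_sequentially)
qed

end

section \<open>Positive elements\<close>

text \<open>
  For real numbers, \<open>\<bar>t - a\<bar> \<le> t\<close> says \<open>0 \<le> a \<le> 2 * t\<close>. Stated by the norm, positivity is visibly stable
  under sums and nonnegative multiples.
\<close>

definition positive_element :: "'a::unital_cstar_algebra \<Rightarrow> bool" where
  "positive_element a \<longleftrightarrow> star a = a \<and> (\<exists>t\<ge>0. norm (t *\<^sub>R 1 - a) \<le> t)"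

lemma positive_star: "positive_element a \<Longrightarrow> star a = a"
  by (simp add: positive_element_def)

lemma positive_zero [simp]: "positive_element 0"
  by (auto simp: positive_element_def intro!: exI[of _ 0])

lemma positive_one [simp]: "positive_element 1"
  by (auto simp: positive_element_def intro!: exI[of _ 1])

lemma positive_add: "positive_element a \<Longrightarrow> positive_element b \<Longrightarrow> positive_element (a + b)"
proof -
  assume "positive_element a" "positive_element b"
  then obtain s t where st: "s \<ge> 0" "t \<ge> 0" "norm (s *\<^sub>R 1 - a) \<le> s" "norm (t *\<^sub>R 1 - b) \<le> t"
    and star: "star a = a" "star b = b"
    unfolding positive_element_def by blast
  have "(s + t) *\<^sub>R 1 - (a + b) = (s *\<^sub>R 1 - a) + (t *\<^sub>R 1 - b)"
    by (simp add: algebra_simps)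
  then have "norm ((s + t) *\<^sub>R 1 - (a + b)) \<le> s + t"
    using norm_triangle_mono[OF st(3,4)] by metis
  then show ?thesis
    using star st unfolding positive_element_def by (auto simp: star_simps intro!: exI[of _ "s + t"])
qed

lemma positive_scaleR: "positive_element a \<Longrightarrow> 0 \<le> r \<Longrightarrow> positive_element (r *\<^sub>R a)"
proof -
  assume "positive_element a" and r: "0 \<le> r"
  then obtain t where t: "t \<ge> 0" "norm (t *\<^sub>R 1 - a) \<le> t" and star: "star a = a"
    unfolding positive_element_def by blast
  have "(r * t) *\<^sub>R 1 - r *\<^sub>R a = r *\<^sub>R (t *\<^sub>R 1 - a)"
    by (simp add: algebra_simps)
  then have "norm ((r * t) *\<^sub>R 1 - r *\<^sub>R a) \<le> r * t"
    using t r by (simp add: mult_left_mono)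
  then show ?thesis
    using star t r unfolding positive_element_def by (auto simp: star_simps intro!: exI[of _ "r * t"])
qed

lemma positive_sum: "(\<And>i. i \<in> S \<Longrightarrow> positive_element (f i)) \<Longrightarrow> positive_element (sum f S)"
  by (induction S rule: infinite_finite_induct) (simp_all add: positive_add)

text \<open>
  After division by \<open>t\<close>, the element has the form \<open>1 - x\<close> with \<open>\<parallel>x\<parallel> \<le> 1\<close>.
\<close>

lemma positive_sqrt:
  assumes "positive_element a"
  obtains g where "positive_element g" "g * g = a" "\<And>S. closed_subalgebra S \<Longrightarrow> a \<in> S \<Longrightarrow> g \<in> S"
proof -
  obtain t where t: "t \<ge> 0" "norm (t *\<^sub>R 1 - a) \<le> t" and star: "star a = a"
    using assms unfolding positive_element_def by blast
  show ?thesis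
  proof (cases "t = 0")
    case True
    with t have "a = 0" by simp
    then show ?thesis by (intro that[of 0]) auto
  next
    case False
    define x where "x = 1 - (1 / t) *\<^sub>R a"
    have "x = (1 / t) *\<^sub>R (t *\<^sub>R 1 - a)"
      using False by (simp add: x_def scaleR_diff_right)
    then have "norm x = norm (t *\<^sub>R 1 - a) / t" using t by simp
    then have x: "norm x \<le> 1" using t False by (simp add: divide_le_eq_1)
    have "star x = x" using star by (simp add: x_def star_simps)
    then have "positive_element (sqrt_one_minus x)"
      unfolding positive_element_def using norm_one_minus_sqrt_one_minus[OF x] star_sqrt_one_minus[OF x]
      by (auto intro!: exI[of _ 1])
    then have "positive_element (sqrt t *\<^sub>R sqrt_one_minus x)"
      using t by (simp add: positive_scaleR)
    moreover have "(sqrt t *\<^sub>R sqrt_one_minus x) * (sqrt t *\<^sub>R sqrt_one_minus x) = a"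
      using t False by (simp add: sqrt_one_minus_square[OF x]) (simp add: x_def)
    moreover have "sqrt t *\<^sub>R sqrt_one_minus x \<in> S" if S: "closed_subalgebra S" "a \<in> S" for S
    proof -
      have "x = 1 + (- (1 / t)) *\<^sub>R a" by (simp add: x_def)
      then have "x \<in> S" using S unfolding closed_subalgebra_def by metis
      then show ?thesis
        using sqrt_one_minus_mem[OF x S(1)] S(1) unfolding closed_subalgebra_def by blast
    qed
    ultimately show ?thesis by (rule that)
  qed
qed

lemma positive_sqrt_commuting:
  assumes "positive_element a" "a * b = b * a"
  obtains g where "positive_element g" "g * g = a" "g * b = b * g"
proof -
  obtain g where g: "positive_element g" "g * g = a" "\<And>S. closed_subalgebra S \<Longrightarrow> a \<in> S \<Longrightarrow> g \<in> S"
    using positive_sqrt[OF assms(1)] by blast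
  have "g \<in> {x. x * b = b * x}"
    by (rule g(3)[OF closed_subalgebra_commutant]) (simp add: assms(2))
  then show ?thesis using g that by blast
qed

lemma cartesian_norm_square:
  fixes g h :: "'a::cstar_algebra"
  assumes "star g = g" "star h = h" "g * h = h * g"
  shows "star (g + \<i> *\<^sub>C h) * (g + \<i> *\<^sub>C h) = g * g + h * h"
  using assms
  by (simp add: star_simps distrib_left distrib_right left_diff_distrib right_diff_distrib
      scaleC_add_right scaleC_diff_right mult_scaleC_left mult_scaleC_right scaleC_scaleC scaleC_minus_one)

lemma norm_real_part_le:
  fixes g h :: "'a::cstar_algebra"
  assumes "star g = g" "star h = h"
  shows "norm g \<le> norm (g + \<i> *\<^sub>C h)"
proof -
  let ?u = "g + \<i> *\<^sub>C h"
  have "2 *\<^sub>R g = ?u + star ?u" using assms by (simp add: star_simps scaleR_2)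
  then have "2 * norm g \<le> norm ?u + norm (star ?u)"
    using norm_triangle_ineq[of ?u "star ?u"] by (metis abs_numeral norm_scaleR)
  then show ?thesis by simp
qed

text \<open>
  Under these hypotheses \<open>g + \<i> h\<close> is an isometry, and \<open>g\<close> is its real part.
\<close>

lemma norm_le_one_of_squares_eq_one:
  fixes g h :: "'a::unital_cstar_algebra"
  assumes "star g = g" "star h = h" "g * h = h * g" "g * g + h * h = 1"
  shows "norm g \<le> 1"
proof -
  let ?u = "g + \<i> *\<^sub>C h"
  have "(norm ?u)\<^sup>2 = 1"
    using cartesian_norm_square[OF assms(1-3)] assms(4) by (metis cstar_identity norm_one)
  then have "norm ?u = 1" using norm_ge_zero[of ?u] by (simp add: power2_eq_1_iff)
  then show ?thesis using norm_real_part_le[OF assms(1,2)] by simp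
qed

text \<open>
  With \<open>h\<close> a square root of \<open>1 - g\<^sup>2\<close>, the pair \<open>h, g\<close> is a cosine and a sine, so \<open>h\<close> is a contraction;
  and \<open>1 - g\<^sup>2\<close> is \<open>h\<^sup>2\<close>.
\<close>

lemma norm_one_minus_square_le:
  fixes g :: "'a::unital_cstar_algebra"
  assumes "star g = g" "norm g \<le> 1"
  shows "norm (1 - g * g) \<le> 1"
proof -
  let ?h = "sqrt_one_minus (g * g)"
  have x: "norm (g * g) \<le> 1"
    using assms by (simp add: cstar_square power_le_one)
  have "g * g \<in> {x. x * g = g * x}" by (simp add: mult.assoc)
  then have "?h * g = g * ?h"
    using sqrt_one_minus_mem[OF x closed_subalgebra_commutant[of g]] by blast
  moreover have star: "star ?h = ?h"
    by (rule star_sqrt_one_minus[OF x]) (simp add: star_simps assms)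
  moreover have sq: "?h * ?h = 1 - g * g" by (rule sqrt_one_minus_square[OF x])
  ultimately have "norm ?h \<le> 1"
    using norm_le_one_of_squares_eq_one[of ?h g] assms by simp
  then show ?thesis unfolding sq[symmetric] cstar_square[OF star] by (simp add: power_le_one)
qed

text \<open>
  The defining inequality, known for one \<open>t\<close>, passes to every \<open>t \<ge> \<parallel>a\<parallel>\<close> because \<open>a\<close> is a square.
  This gives the positive cone a uniform description, from which its closedness follows.
\<close>

lemma positive_norm_diff:
  assumes "positive_element a" "norm a \<le> t"
  shows "norm (t *\<^sub>R 1 - a) \<le> t"
proof (cases "t = 0")
  case False
  with assms(2) norm_ge_zero[of a] have t: "t > 0" by linarith
  obtain g where g: "positive_element g" "g * g = a" using positive_sqrt[OF assms(1)] by blast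
  let ?g = "(1 / sqrt t) *\<^sub>R g"
  have "(norm g)\<^sup>2 \<le> t" using assms(2) g cstar_square[of g] by (simp add: positive_star)
  then have "norm g \<le> sqrt t" using real_le_rsqrt by blast
  then have "norm ?g \<le> 1" using t by (simp add: field_simps)
  then have "norm (1 - ?g * ?g) \<le> 1"
    by (intro norm_one_minus_square_le) (simp_all add: star_simps positive_star g)
  moreover have "t *\<^sub>R 1 - a = t *\<^sub>R (1 - ?g * ?g)"
    using t g by (simp add: scaleR_diff_right)
  ultimately show ?thesis using t by (simp add: mult_left_le)
qed (use assms in simp)

lemma positive_square:
  fixes g :: "'a::unital_cstar_algebra"
  assumes "star g = g"
  shows "positive_element (g * g)"
proof (cases "g = 0")
  case False
  let ?g = "(1 / norm g) *\<^sub>R g"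
  have "norm (1 - ?g * ?g) \<le> 1"
    by (intro norm_one_minus_square_le) (simp_all add: star_simps assms)
  then have "positive_element (?g * ?g)"
    unfolding positive_element_def by (auto simp: star_simps assms intro!: exI[of _ 1])
  then have "positive_element ((norm g * norm g) *\<^sub>R (?g * ?g))" by (rule positive_scaleR) simp
  then show ?thesis using False by simp
qed simp

lemma positive_tendsto:
  assumes "\<And>n. positive_element (X n)" "X \<longlonglongrightarrow> L"
  shows "positive_element L"
proof -
  obtain K where K: "\<And>n. norm (X n) \<le> K"
    using convergent_imp_Bseq[of X] assms(2) unfolding convergent_def Bseq_def by blast
  have "(\<lambda>n. norm (K *\<^sub>R 1 - X n)) \<longlonglongrightarrow> norm (K *\<^sub>R 1 - L)"
    by (intro tendsto_intros assms)
  then have "norm (K *\<^sub>R 1 - L) \<le> K"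
    by (rule LIMSEQ_le_const2) (use positive_norm_diff[OF assms(1) K] in blast)
  moreover have "K \<ge> 0" using K[of 0] norm_ge_zero[of "X 0"] by linarith
  moreover have "star L = L"
    using tendsto_star[OF assms(2)] assms by (simp add: positive_star LIMSEQ_unique)
  ultimately show ?thesis unfolding positive_element_def by blast
qed

lemma positive_mult_commuting:
  assumes "positive_element a" "positive_element b" "a * b = b * a"
  shows "positive_element (a * b)"
proof -
  obtain g where g: "positive_element g" "g * g = a" "g * b = b * g"
    using positive_sqrt_commuting[OF assms(1,3)] .
  obtain h where h: "positive_element h" "h * h = b" "h * g = g * h"
    using positive_sqrt_commuting[OF assms(2), of g] g(3) by metis
  have "(g * h) * (g * h) = a * b"
    by (metis g(2) h(2,3) mult.assoc)
  moreover have "star (g * h) = g * h" by (simp add: star_simps positive_star g h)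
  ultimately show ?thesis using positive_square by metis
qed

text \<open>
  If \<open>a = g\<^sup>2\<close> and \<open>- a = h\<^sup>2\<close> with commuting \<open>g, h\<close>, then \<open>u = g + \<i> h\<close> satisfies \<open>u\<^sup>* u = 0\<close>.
\<close>

lemma positive_antisym:
  assumes "positive_element a" "positive_element (- a)"
  shows "a = 0"
proof -
  obtain g where g: "positive_element g" "g * g = a" "g * (-a) = (-a) * g"
    using positive_sqrt_commuting[OF assms(1), of "-a"] by auto
  obtain h where h: "positive_element h" "h * h = - a" "h * g = g * h"
    using positive_sqrt_commuting[OF assms(2), of g] g(3) by metis
  have "star (g + \<i> *\<^sub>C h) * (g + \<i> *\<^sub>C h) = 0"
    using cartesian_norm_square[of g h] g h by (simp add: positive_star)
  then have "norm (g + \<i> *\<^sub>C h) = 0"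
    using cstar_identity[of "g + \<i> *\<^sub>C h"] by simp
  then have "g = 0"
    using norm_real_part_le[of g h] g h by (simp add: positive_star)
  then show ?thesis using g by simp
qed

lemma positive_add_eq_one:
  assumes "positive_element a" "positive_element b" "a + b = 1"
  shows "norm a \<le> 1"
proof -
  have "b = 1 - a" using assms(3) by (simp add: algebra_simps)
  then have "a * b = b * a" by (simp only: left_diff_distrib right_diff_distrib mult_1 mult_1_right)
  then obtain g where g: "positive_element g" "g * g = a" "g * b = b * g"
    using positive_sqrt_commuting[OF assms(1)] by metis
  obtain h where h: "positive_element h" "h * h = b" "h * g = g * h"
    using positive_sqrt_commuting[OF assms(2), of g] g(3) by metis
  have "norm g \<le> 1"
    using norm_le_one_of_squares_eq_one[of g h] g h assms by (simp add: positive_star)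
  then show ?thesis
    using cstar_square[of g] g by (simp add: positive_star power_le_one)
qed

lemma positive_norm_le:
  assumes "positive_element a" "positive_element (t *\<^sub>R 1 - a)" "t \<ge> 0"
  shows "norm a \<le> t"
proof (cases "t = 0")
  case True
  then show ?thesis using positive_antisym[of a] assms by simp
next
  case False
  have "norm ((1 / t) *\<^sub>R a) \<le> 1"
  proof (rule positive_add_eq_one)
    show "positive_element ((1 / t) *\<^sub>R a)" "positive_element ((1 / t) *\<^sub>R (t *\<^sub>R 1 - a))"
      using assms by (simp_all add: positive_scaleR)
    show "(1 / t) *\<^sub>R a + (1 / t) *\<^sub>R (t *\<^sub>R 1 - a) = 1"
      using False by (simp add: scaleR_diff_right)
  qed
  then show ?thesis using assms False by (simp add: field_simps)
qed

text \<open>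
  For self-adjoint \<open>d\<close> the \<open>C\<^sup>*\<close>-identity gives \<open>\<parallel>d^(2^k)\<parallel> = \<parallel>d\<parallel>^(2^k)\<close>, which would grow exponentially
  in \<open>2^k\<close> if \<open>\<parallel>d\<parallel> > 1\<close>. This substitutes for a bound on the spectrum of \<open>d\<close>.
\<close>

lemma norm_le_one_of_power_growth:
  fixes d :: "'a::unital_cstar_algebra"
  assumes "star d = d" "\<And>n. norm (d ^ n) \<le> 1 + C * real n"
  shows "norm d \<le> 1"
proof (rule ccontr)
  assume "\<not> norm d \<le> 1"
  define \<delta> where "\<delta> = norm d - 1"
  have \<delta>: "\<delta> > 0" using \<open>\<not> norm d \<le> 1\<close> by (simp add: \<delta>_def)
  have pow: "norm (d ^ 2 ^ k) = norm d ^ 2 ^ k" for k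
  proof (induction k)
    case (Suc k)
    have "norm (d ^ 2 ^ k * d ^ 2 ^ k) = (norm (d ^ 2 ^ k))\<^sup>2"
      by (rule cstar_square) (simp add: star_power assms)
    then show ?case using Suc by (simp add: mult_2 power_add power2_eq_square)
  qed simp
  obtain k :: nat where k: "real k > 2 * C / \<delta>\<^sup>2" using reals_Archimedean2 by blast
  define m where "m = (2::nat) ^ k"
  have "real k < real m" by (simp add: m_def)
  with k \<delta> have "2 * C < real m * \<delta>\<^sup>2" by (simp add: field_simps) (metis less_trans mult.commute mult_strict_right_mono zero_less_power of_nat_less_iff)
  moreover have "m > 0" by (simp add: m_def)
  ultimately have lt: "2 * C * real m < (real m * \<delta>)\<^sup>2"
    by (simp add: power_mult_distrib power2_eq_square) (simp add: ac_simps)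
  have "(1 + real m * \<delta>)\<^sup>2 \<le> ((1 + \<delta>) ^ m)\<^sup>2"
    using \<delta> by (intro power_mono Bernoulli_inequality) auto
  also have "\<dots> = norm d ^ 2 ^ Suc k"
    by (simp add: \<delta>_def m_def flip: power_mult) (simp add: mult.commute)
  also have "\<dots> \<le> 1 + C * (2 * real m)"
    using assms(2)[of "2 ^ Suc k"] pow[of "Suc k"] by (simp add: m_def)
  finally have "2 * (real m * \<delta>) + (real m * \<delta>)\<^sup>2 \<le> 2 * C * real m"
    by (simp add: power2_sum)
  with lt \<delta> show False by (smt (verit) mult_nonneg_nonneg of_nat_0_le_iff)
qed

text \<open>
  Here \<open>w\<close> stands for \<open>\<bar>a\<bar>\<close> and \<open>p = (w + a) / 2\<close> for the positive part. From \<open>p\<^sup>2 = p w\<close> follows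
  \<open>p (1 - p)^n = p (1 - w)^n\<close>, so \<open>(1 - p)^n\<close> telescopes into \<open>1\<close> minus \<open>n\<close> terms of norm at most \<open>\<parallel>p\<parallel>\<close>,
  and linear growth forces \<open>\<parallel>1 - p\<parallel> \<le> 1\<close>.
\<close>

lemma positive_half_sum_abs:
  fixes a w :: "'a::unital_cstar_algebra"
  assumes "star a = a" "star w = w" "w * a = a * w" "w * w = a * a" "norm (1 - w) \<le> 1"
  shows "positive_element ((1/2) *\<^sub>R (w + a))"
proof -
  define p where "p = (1/2) *\<^sub>R (w + a)"
  have star: "star p = p" by (simp add: p_def star_simps assms)
  have comm: "w * p = p * w" by (simp add: p_def assms algebra_simps)
  have pp: "p * p = p * w"
  proof -
    have "p * p = (1/4) *\<^sub>R ((w + a) * (w + a))" by (simp add: p_def)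
    also have "(w + a) * (w + a) = 2 *\<^sub>R ((w + a) * w)"
      using assms by (simp add: algebra_simps scaleR_2)
    finally show ?thesis by (simp add: p_def)
  qed
  have shift: "p * (1 - p) ^ n = p * (1 - w) ^ n" for n
  proof (induction n)
    case (Suc n)
    have "p * (1 - p) ^ Suc n = (p * (1 - p) ^ n) * (1 - p)"
      by (simp only: power_Suc2 mult.assoc)
    also have "\<dots> = (p * (1 - w) ^ n) * (1 - p)" using Suc by simp
    also have "\<dots> = (1 - w) ^ n * (p * (1 - p))"
    proof -
      have "p * (1 - w) = (1 - w) * p" using comm by (simp add: algebra_simps)
      then have "p * (1 - w) ^ n = (1 - w) ^ n * p" by (metis power_commuting_commutes)
      then show ?thesis by (simp add: mult.assoc)
    qed
    also have "p * (1 - p) = p * (1 - w)" by (simp add: algebra_simps pp)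
    also have "\<dots> = (1 - w) * p" by (simp add: algebra_simps comm)
    also have "(1 - w) ^ n * ((1 - w) * p) = (1 - w) ^ Suc n * p"
      by (simp only: power_Suc2 mult.assoc)
    also have "\<dots> = p * (1 - w) ^ Suc n"
    proof -
      have "(1 - w) * p = p * (1 - w)" using comm by (simp add: algebra_simps)
      then show ?thesis by (metis power_commuting_commutes)
    qed
    finally show ?case .
  qed simp
  have expand: "(1 - p) ^ n = 1 - (\<Sum>k<n. p * (1 - w) ^ k)" for n
  proof (induction n)
    case (Suc n)
    have "(1 - p) ^ Suc n = (1 - p) ^ n - p * (1 - p) ^ n" by (simp add: algebra_simps)
    then show ?case using Suc shift[of n] by simp
  qed simp
  have "norm ((1 - p) ^ n) \<le> 1 + norm p * real n" for n
  proof -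
    have le: "norm (p * (1 - w) ^ k) \<le> norm p" for k
    proof -
      have "norm ((1 - w) ^ k) \<le> 1"
        using norm_power_ineq[of "1 - w" k] power_le_one[OF norm_ge_zero assms(5), of k]
        by linarith
      then show ?thesis
        using norm_mult_ineq[of p "(1 - w) ^ k"] by (meson mult_left_le norm_ge_zero order_trans)
    qed
    have "norm ((1 - p) ^ n) \<le> norm (1::'a) + norm (\<Sum>k<n. p * (1 - w) ^ k)"
      unfolding expand by (rule norm_triangle_ineq4)
    also have "norm (\<Sum>k<n. p * (1 - w) ^ k) \<le> (\<Sum>k<n. norm p)"
      by (rule sum_norm_le) (rule le)
    finally show ?thesis by (simp add: mult.commute)
  qed
  then have "norm (1 - p) \<le> 1"
    by (rule norm_le_one_of_power_growth[rotated]) (simp add: star_simps star)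
  then show ?thesis
    using star unfolding positive_element_def p_def[symmetric] by (auto intro!: exI[of _ 1])
qed

lemma positive_negative_parts:
  fixes a :: "'a::unital_cstar_algebra"
  assumes "star a = a"
  obtains u v where "positive_element u" "positive_element v" "u * v = 0" "v * u = 0" "a = u - v"
proof -
  have unit_ball: "\<exists>u v. positive_element u \<and> positive_element v \<and> u * v = 0 \<and> v * u = 0 \<and> b = u - v"
    if b: "star b = b" "norm b \<le> 1" for b :: 'a
  proof -
    let ?w = "sqrt_one_minus (1 - b * b)"
    let ?u = "(1/2) *\<^sub>R (?w + b)" and ?v = "(1/2) *\<^sub>R (?w + - b)"
    have x: "norm (1 - b * b) \<le> 1" using b by (rule norm_one_minus_square_le)
    have w: "star ?w = ?w" "?w * ?w = b * b" "norm (1 - ?w) \<le> 1"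
      using sqrt_one_minus_square[OF x] norm_one_minus_sqrt_one_minus[OF x]
      by (simp_all add: star_sqrt_one_minus[OF x] star_simps b)
    have "1 - b * b \<in> {x. x * b = b * x}" by (simp add: algebra_simps)
    then have comm: "?w * b = b * ?w"
      using sqrt_one_minus_mem[OF x closed_subalgebra_commutant[of b]] by blast
    have "positive_element ?u" using b w comm by (intro positive_half_sum_abs) simp_all
    moreover have "positive_element ?v" using b w comm by (intro positive_half_sum_abs) simp_all
    moreover have "?u * ?v = 0" "?v * ?u = 0"
      using w comm by (simp_all add: algebra_simps)
    moreover have "b = ?u - ?v"
      unfolding scaleR_diff_right[symmetric] by (simp add: scaleR_2[symmetric] del: scaleR_half_double)
    ultimately show ?thesis by blast
  qed
  have "\<exists>u v. positive_element u \<and> positive_element v \<and> u * v = 0 \<and> v * u = 0 \<and> (1 / norm a) *\<^sub>R a = u - v"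
    by (rule unit_ball) (simp_all add: star_simps assms)
  then obtain u v where uv: "positive_element u" "positive_element v" "u * v = 0" "v * u = 0"
    "(1 / norm a) *\<^sub>R a = u - v" by blast
  have "a = norm a *\<^sub>R ((1 / norm a) *\<^sub>R a)" by (cases "a = 0") simp_all
  then have "a = norm a *\<^sub>R u - norm a *\<^sub>R v" by (simp add: uv(5) scaleR_diff_right)
  then show ?thesis
    using uv by (intro that[of "norm a *\<^sub>R u" "norm a *\<^sub>R v"]) (simp_all add: positive_scaleR)
qed

text \<open>
  Usually this is read off from the fact that \<open>z\<^sup>* z\<close> and \<open>z z\<^sup>*\<close> have the same nonzero spectrum. Instead,
  scale \<open>z\<close> to \<open>y\<close> with \<open>\<parallel>1 + y\<^sup>* y\<parallel> \<le> 1\<close>. Since \<open>(1 + y y\<^sup>*)^n y = y (1 + y\<^sup>* y)^n\<close>, the powers of \<open>1 + y y\<^sup>*\<close>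
  grow at most linearly.
\<close>

lemma positive_minus_swap:
  fixes z :: "'a::unital_cstar_algebra"
  assumes "positive_element (- (star z * z))"
  shows "positive_element (- (z * star z))"
proof (cases "z = 0")
  case False
  define t where "t = (norm z)\<^sup>2"
  have t: "t > 0" using False by (simp add: t_def)
  define y where "y = (1 / norm z) *\<^sub>R z"
  have yz: "star z * z = t *\<^sub>R (star y * y)" "z * star z = t *\<^sub>R (y * star y)"
    using False by (simp_all add: y_def t_def star_simps power2_eq_square)
  have "norm (t *\<^sub>R 1 - (- (star z * z))) \<le> t"
    using assms by (rule positive_norm_diff) (simp add: t_def cstar_identity)
  moreover have "t *\<^sub>R 1 - (- (star z * z)) = t *\<^sub>R (1 + star y * y)"
    by (simp add: yz scaleR_add_right)
  ultimately have le1: "norm (1 + star y * y) \<le> 1" using t by simp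
  have shift: "(1 + y * star y) ^ n * y = y * (1 + star y * y) ^ n" for n
  proof (induction n)
    case (Suc n)
    have "(1 + y * star y) ^ Suc n * y = (1 + y * star y) * ((1 + y * star y) ^ n * y)"
      by (simp add: mult.assoc)
    also have "\<dots> = y * ((1 + star y * y) * (1 + star y * y) ^ n)"
      unfolding Suc by (simp add: algebra_simps)
    finally show ?case by simp
  qed simp
  have expand: "(1 + y * star y) ^ n = 1 + (\<Sum>k<n. y * (1 + star y * y) ^ k * star y)" for n
  proof (induction n)
    case (Suc n)
    have "(1 + y * star y) ^ Suc n = (1 + y * star y) ^ n + ((1 + y * star y) ^ n * y) * star y"
      by (simp add: power_Suc2 distrib_left mult.assoc del: power_Suc)
    then show ?case using Suc shift[of n] by (simp add: add.assoc)
  qed simp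
  have "norm ((1 + y * star y) ^ n) \<le> 1 + (norm y * norm y) * real n" for n
  proof -
    have le: "norm (y * (1 + star y * y) ^ k * star y) \<le> norm y * norm y" for k
    proof -
      have "norm ((1 + star y * y) ^ k) \<le> 1"
        using norm_power_ineq[of "1 + star y * y" k] power_le_one[OF norm_ge_zero le1, of k]
        by linarith
      then have "norm (y * (1 + star y * y) ^ k) \<le> norm y"
        using norm_mult_ineq[of y "(1 + star y * y) ^ k"]
        by (meson mult_left_le norm_ge_zero order_trans)
      then show ?thesis
        using norm_mult_ineq[of "y * (1 + star y * y) ^ k" "star y"]
        by (metis (no_types, lifting) mult_right_mono norm_ge_zero norm_star order_trans)
    qed
    have "norm ((1 + y * star y) ^ n)
        \<le> norm (1::'a) + norm (\<Sum>k<n. y * (1 + star y * y) ^ k * star y)"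
      unfolding expand by (rule norm_triangle_ineq)
    also have "norm (\<Sum>k<n. y * (1 + star y * y) ^ k * star y) \<le> (\<Sum>k<n. norm y * norm y)"
      by (rule sum_norm_le) (rule le)
    finally show ?thesis by (simp add: mult.commute)
  qed
  then have "norm (1 + y * star y) \<le> 1"
    by (rule norm_le_one_of_power_growth[rotated]) (simp add: star_simps)
  then have "positive_element (- (y * star y))"
    unfolding positive_element_def by (auto simp: star_simps intro!: exI[of _ 1])
  then have "positive_element (t *\<^sub>R (- (y * star y)))" using t by (intro positive_scaleR) simp_all
  then show ?thesis by (simp add: yz)
qed simp

text \<open>
  Kaplansky's argument. If \<open>v\<close> is the negative part of \<open>y\<^sup>* y\<close>, then \<open>z = y v\<close> satisfies \<open>z\<^sup>* z = - v\<^sup>3\<close>, so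
  \<open>z\<^sup>* z\<close> and hence \<open>z z\<^sup>*\<close> are negative. Their sum, though, is half of \<open>(z + z\<^sup>*)\<^sup>2 - (z - z\<^sup>*)\<^sup>2\<close>, which is a sum of
  squares of self-adjoint elements. Therefore \<open>z\<^sup>* z = 0\<close> and \<open>v = 0\<close>.
\<close>

theorem positive_star_mult_self: "positive_element (star y * y)"
proof -
  define a where "a = star y * y"
  have "star a = a" by (simp add: a_def star_simps)
  then obtain u v where uv: "positive_element u" "positive_element v" "u * v = 0" "v * u = 0" "a = u - v"
    using positive_negative_parts by blast
  define z where "z = y * v"
  have "star z * z = v * a * v"
    by (simp add: z_def a_def star_simps positive_star uv mult.assoc)
  also have "\<dots> = - (v * (v * v))" by (simp add: uv algebra_simps flip: mult.assoc)
  finally have zz: "star z * z = - (v * (v * v))" .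
  have "positive_element (v * (v * v))"
    using uv(2) by (intro positive_mult_commuting positive_square) (simp_all add: mult.assoc positive_star)
  then have neg: "positive_element (- (star z * z))" by (simp add: zz)
  have "positive_element ((z + star z) * (z + star z))"
    by (rule positive_square) (simp add: star_simps)
  moreover have "positive_element ((\<i> *\<^sub>C (z - star z)) * (\<i> *\<^sub>C (z - star z)))"
    by (rule positive_square) (simp add: star_simps scaleC_diff_right)
  moreover have "(\<i> *\<^sub>C (z - star z)) * (\<i> *\<^sub>C (z - star z)) = - ((z - star z) * (z - star z))"
    by (simp add: mult_scaleC_left mult_scaleC_right scaleC_scaleC scaleC_minus_one)
  ultimately have "positive_element ((z + star z) * (z + star z) + - ((z - star z) * (z - star z)))"
    by (metis positive_add)
  moreover have "(z + star z) * (z + star z) + - ((z - star z) * (z - star z))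
      = 2 *\<^sub>R (star z * z + z * star z)"
    by (simp add: algebra_simps scaleR_2)
  ultimately have "positive_element ((1/2) *\<^sub>R (2 *\<^sub>R (star z * z + z * star z)))"
    by (metis positive_scaleR zero_le_divide_1_iff zero_le_numeral)
  then have "positive_element (star z * z + z * star z)" by simp
  then have "positive_element (star z * z + z * star z + - (z * star z))"
    using positive_minus_swap[OF neg] by (rule positive_add)
  then have "star z * z = 0" using neg positive_antisym by simp
  then have "v * (v * v) = 0" using zz by simp
  then have "(v * v) * (v * v) = 0" by (simp add: mult.assoc)
  then have "norm (v * v) = 0"
    using cstar_square[of "v * v"] uv(2) by (simp add: star_simps positive_star)
  then have "v = 0" using cstar_square[of v] uv(2) by (simp add: positive_star)
  then show ?thesis using uv a_def by simp
qed

lemma positive_conjugate: "positive_element a \<Longrightarrow> positive_element (star c * a * c)"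
  using positive_sqrt[of a] positive_star_mult_self
  by (metis mult.assoc positive_star star_mult)

lemma neumann_inverse:
  fixes x :: "'a::{real_normed_algebra_1, banach}"
  assumes "norm x < 1"
  obtains y where "y * (1 - x) = 1" "(1 - x) * y = 1"
proof -
  have sumN: "summable (\<lambda>n. x ^ n)"
    by (rule summable_norm_cancel, rule summable_comparison_test'[OF summable_geometric[of "norm x"]])
      (use assms norm_power_ineq[of x] in auto)
  have tail: "(\<Sum>n. x ^ Suc n) = (\<Sum>n. x ^ n) - 1"
    using suminf_split_head[OF sumN] by simp
  have "x * (\<Sum>n. x ^ n) = (\<Sum>n. x ^ n) - 1" "(\<Sum>n. x ^ n) * x = (\<Sum>n. x ^ n) - 1"
    unfolding tail[symmetric]
    by (simp_all add: suminf_mult[OF sumN] suminf_mult2[OF sumN] power_commutes)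
  then show ?thesis by (intro that[of "\<Sum>n. x ^ n"]) (simp_all add: algebra_simps)
qed

text \<open>
  \<open>1 + q\<close> is a multiple of \<open>1 - x\<close> with \<open>\<parallel>x\<parallel> < 1\<close>. Its inverse \<open>r = r (1 + q) r = r\<^sup>2 + r q r\<close> is positive, and
  both norm bounds come from \<open>r + q r = 1\<close> with positive summands.
\<close>

lemma positive_one_plus_inverse:
  fixes q :: "'a::unital_cstar_algebra"
  assumes q: "positive_element q"
  obtains r where "r * (1 + q) = 1" "(1 + q) * r = 1" "positive_element r" "norm r \<le> 1" "norm (q * r) \<le> 1"
proof -
  define t where "t = norm q"
  define x where "x = (1 / (1 + t)) *\<^sub>R (t *\<^sub>R 1 - q)"
  have t: "t \<ge> 0" by (simp add: t_def)
  have "norm (t *\<^sub>R 1 - q) \<le> t" by (rule positive_norm_diff[OF q]) (simp add: t_def)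
  moreover have "norm x = norm (t *\<^sub>R 1 - q) / (1 + t)" using t by (simp only: x_def) simp
  ultimately have "norm x < 1" using t by (simp add: divide_less_eq)
  then obtain y where y: "y * (1 - x) = 1" "(1 - x) * y = 1" using neumann_inverse by blast
  have "(1 + t) *\<^sub>R x = t *\<^sub>R 1 - q" using t by (simp only: x_def) simp
  then have "(1 + t) *\<^sub>R (1 - x) = 1 + q"
    by (simp add: scaleR_diff_right scaleR_add_left)
  moreover have "1 - x = (1 / (1 + t)) *\<^sub>R ((1 + t) *\<^sub>R (1 - x))" using t by simp
  ultimately have x': "1 - x = (1 / (1 + t)) *\<^sub>R (1 + q)" by simp
  define r where "r = (1 / (1 + t)) *\<^sub>R y"
  have r: "r * (1 + q) = 1" "(1 + q) * r = 1"
    using y by (simp_all add: r_def x')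
  have star: "star r = r"
  proof -
    have "star r * (1 + q) = 1"
      using arg_cong[OF r(2), of star] by (simp add: star_simps positive_star[OF q])
    then show ?thesis by (metis mult.assoc mult_1 mult_1_right r(2))
  qed
  have comm: "q * r = r * q" using r by (simp add: algebra_simps) (metis add_left_cancel)
  have "r = r * (1 + q) * r" using r by simp
  then have "r = r * r + star r * q * r" by (simp add: star algebra_simps)
  then have pr: "positive_element r"
    using positive_add[OF positive_square[OF star] positive_conjugate[OF q, of r]] by simp
  then have pqr: "positive_element (q * r)" using q comm by (intro positive_mult_commuting)
  have "r + q * r = 1" using r by (simp add: algebra_simps)
  then have "norm r \<le> 1" "norm (q * r) \<le> 1"
    using positive_add_eq_one[OF pr pqr] positive_add_eq_one[OF pqr pr] by (simp_all add: add.commute)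
  then show ?thesis using r pr that by blast
qed

lemma positive_norm_minus:
  assumes "star b = b" "norm b \<le> t"
  shows "positive_element (t *\<^sub>R 1 - b)"
  unfolding positive_element_def using assms norm_ge_zero[of b]
  by (auto simp: star_simps intro!: exI[of _ t] simp del: norm_ge_zero)

lemma positive_norm_mono:
  assumes "positive_element a" "positive_element (b - a)"
  shows "norm a \<le> norm b"
proof (rule positive_norm_le[OF assms(1)])
  have "star b = b"
    using positive_star[OF positive_add[OF assms]] by simp
  then have "positive_element (norm b *\<^sub>R 1 - b)" by (simp add: positive_norm_minus)
  then show "positive_element (norm b *\<^sub>R 1 - a)"
    using positive_add[OF _ assms(2), of "norm b *\<^sub>R 1 - b"] by simp
qed simp

section \<open>Closed ideals\<close>

lemma ideal_mult_left: "closed_two_sided_ideal J \<Longrightarrow> x \<in> J \<Longrightarrow> a * x \<in> J"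
  and ideal_mult_right: "closed_two_sided_ideal J \<Longrightarrow> x \<in> J \<Longrightarrow> x * a \<in> J"
  and ideal_zero: "closed_two_sided_ideal J \<Longrightarrow> 0 \<in> J"
  and ideal_add: "closed_two_sided_ideal J \<Longrightarrow> x \<in> J \<Longrightarrow> y \<in> J \<Longrightarrow> x + y \<in> J"
  and ideal_scaleC: "closed_two_sided_ideal J \<Longrightarrow> x \<in> J \<Longrightarrow> c *\<^sub>C x \<in> J"
  and ideal_closed: "closed_two_sided_ideal J \<Longrightarrow> closed J"
  by (simp_all add: closed_two_sided_ideal_def)

lemma ideal_scaleR: "closed_two_sided_ideal J \<Longrightarrow> x \<in> J \<Longrightarrow> r *\<^sub>R x \<in> J"
  by (metis ideal_scaleC scaleC_of_real)

lemma ideal_sum: "closed_two_sided_ideal J \<Longrightarrow> (\<And>i. i \<in> S \<Longrightarrow> f i \<in> J) \<Longrightarrow> sum f S \<in> J"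
  by (induction S rule: infinite_finite_induct) (simp_all add: ideal_zero ideal_add)

text \<open>
  With \<open>q = j / \<epsilon>\<close>, the element \<open>u = q (1 + q)\<^sup>-\<^sup>1\<close> of \<open>J\<close> nearly acts as a right unit on \<open>y\<close>: the error
  \<open>y - y u = y (1 + q)\<^sup>-\<^sup>1\<close> has squared norm at most \<open>2 \<epsilon>\<close>. So \<open>y\<close> is a limit of elements \<open>y u\<close> of \<open>J\<close>.
\<close>

lemma ideal_mem_of_square_le:
  assumes J: "closed_two_sided_ideal J"
    and le: "\<And>\<epsilon>. \<epsilon> > 0 \<Longrightarrow> \<exists>j\<in>J. positive_element j \<and> positive_element (\<epsilon> *\<^sub>R 1 + j - star y * y)"
  shows "y \<in> J"
  unfolding closed_approachable[OF ideal_closed[OF J], symmetric]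
proof (intro allI impI)
  fix \<delta> :: real assume \<delta>: "\<delta> > 0"
  define \<epsilon> where "\<epsilon> = \<delta>\<^sup>2 / 4"
  have \<epsilon>: "\<epsilon> > 0" using \<delta> by (simp add: \<epsilon>_def)
  obtain j where j: "j \<in> J" "positive_element j" "positive_element (\<epsilon> *\<^sub>R 1 + j - star y * y)"
    using le[OF \<epsilon>] by blast
  have n: "1 / \<epsilon> > 0" using \<epsilon> by simp
  define q where "q = (1 / \<epsilon>) *\<^sub>R j"
  have jq: "j = \<epsilon> *\<^sub>R q" using \<epsilon> by (simp add: q_def)
  have "positive_element q" using j \<epsilon> by (simp add: q_def positive_scaleR)
  then obtain r where r: "(1 + q) * r = 1" "positive_element r" "norm r \<le> 1" "norm (q * r) \<le> 1"
    using positive_one_plus_inverse by metis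
  have sr: "star r = r" using r by (simp add: positive_star)
  have yr: "y * r = y - y * (q * r)"
    using arg_cong[OF r(1), of "\<lambda>x. y * x"] by (simp add: algebra_simps)
  have "star (y * r) * (y * r) = star r * (star y * y) * r" by (simp add: star_simps mult.assoc)
  moreover have "positive_element (star r * (\<epsilon> *\<^sub>R 1 + j - star y * y) * r)"
    by (rule positive_conjugate[OF j(3)])
  ultimately have "positive_element (\<epsilon> *\<^sub>R (r * r) + \<epsilon> *\<^sub>R (r * (q * r)) - star (y * r) * (y * r))"
    by (simp add: sr jq algebra_simps)
  then have "norm (star (y * r) * (y * r)) \<le> norm (\<epsilon> *\<^sub>R (r * r) + \<epsilon> *\<^sub>R (r * (q * r)))"
    using positive_norm_mono positive_star_mult_self by blast
  also have "\<dots> \<le> norm (\<epsilon> *\<^sub>R (r * r)) + norm (\<epsilon> *\<^sub>R (r * (q * r)))" by (rule norm_triangle_ineq)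
  also have "\<dots> \<le> \<epsilon> + \<epsilon>"
  proof (rule add_mono)
    have "norm (r * x) \<le> 1" if "norm x \<le> 1" for x
      using norm_mult_ineq[of r x] mult_le_one[OF r(3) norm_ge_zero that] by linarith
    then show "norm (\<epsilon> *\<^sub>R (r * r)) \<le> \<epsilon>" "norm (\<epsilon> *\<^sub>R (r * (q * r))) \<le> \<epsilon>"
      using r \<epsilon> by (simp_all add: mult_left_le)
  qed
  finally have "(norm (y * r))\<^sup>2 \<le> 2 * \<epsilon>" by (simp add: cstar_identity)
  also have "\<dots> < \<delta>\<^sup>2" using \<delta> by (simp add: \<epsilon>_def)
  finally have "norm (y * r) < \<delta>" using \<delta> by (simp add: power_less_imp_less_base)
  then have "dist (y * (q * r)) y < \<delta>" by (simp add: yr dist_norm norm_minus_commute)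
  moreover have "y * (q * r) \<in> J"
    by (intro ideal_mult_left[OF J] ideal_mult_right[OF J]) (simp add: q_def ideal_scaleR[OF J] j)
  ultimately show "\<exists>z\<in>J. dist z y < \<delta>" by blast
qed

lemma ideal_mem_of_square_mem:
  fixes y :: "'a::unital_cstar_algebra"
  assumes "closed_two_sided_ideal J" "star y * y \<in> J"
  shows "y \<in> J"
  using assms positive_star_mult_self[of y]
  by (intro ideal_mem_of_square_le) (auto intro!: bexI[of _ "star y * y"] positive_scaleR)

text \<open>
  The hypothesis says that \<open>b\<close> has norm at most \<open>1\<close> modulo \<open>J\<close>. Write \<open>b = z - x\<close> with \<open>x \<in> J\<close> and
  \<open>\<parallel>z\<parallel> \<le> 1 + \<eta>\<close>. Positivity of the square of \<open>\<surd>\<eta> z + x / \<surd>\<eta>\<close> trades the mixed terms of \<open>b\<^sup>* b\<close> for multiples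
  of \<open>z\<^sup>* z\<close> and \<open>x\<^sup>* x\<close>, and the latter lies in \<open>J\<close>.
\<close>

lemma quotient_norm_square_bound:
  fixes b :: "'a::unital_cstar_algebra"
  assumes J: "closed_two_sided_ideal J"
    and b: "\<And>\<epsilon>. \<epsilon> > 0 \<Longrightarrow> \<exists>x\<in>J. norm (b + x) \<le> 1 + \<epsilon>"
    and \<kappa>: "\<kappa> > 0"
  obtains j where "j \<in> J" "positive_element j" "positive_element ((1 + \<kappa>) *\<^sub>R 1 + j - star b * b)"
proof -
  \<comment> \<open>\<open>(1 + \<eta>)\<^sup>3 \<le> 1 + 7 \<eta>\<close> for \<open>\<eta> \<le> 1\<close>\<close>
  define \<eta> where "\<eta> = min 1 (\<kappa> / 7)"
  have \<eta>: "\<eta> > 0" "\<eta> \<le> 1" "7 * \<eta> \<le> \<kappa>" using \<kappa> by (auto simp: \<eta>_def)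
  obtain x where x: "x \<in> J" "norm (b + x) \<le> 1 + \<eta>" using b[OF \<eta>(1)] by blast
  define z where "z = b + x"
  define j where "j = (1 + 1 / \<eta>) *\<^sub>R (star x * x)"
  have "positive_element (star (sqrt \<eta> *\<^sub>R z + (1 / sqrt \<eta>) *\<^sub>R x) * (sqrt \<eta> *\<^sub>R z + (1 / sqrt \<eta>) *\<^sub>R x))"
    by (rule positive_star_mult_self)
  also have "star (sqrt \<eta> *\<^sub>R z + (1 / sqrt \<eta>) *\<^sub>R x) * (sqrt \<eta> *\<^sub>R z + (1 / sqrt \<eta>) *\<^sub>R x)
      = \<eta> *\<^sub>R (star z * z) + (1 / \<eta>) *\<^sub>R (star x * x) + star z * x + star x * z"
    using \<eta> by (simp add: star_simps distrib_left distrib_right scaleR_add_right add_ac)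
  also have "\<dots> = (1 + \<eta>) *\<^sub>R (star z * z) + j - star b * b"
    by (simp add: j_def z_def star_simps distrib_left distrib_right scaleR_add_left)
  finally have 1: "positive_element ((1 + \<eta>) *\<^sub>R (star z * z) + j - star b * b)" .
  have "norm (star z * z) \<le> (1 + \<eta>)\<^sup>2"
    unfolding cstar_identity z_def using x by (intro power_mono) auto
  then have "positive_element ((1 + \<eta>)\<^sup>2 *\<^sub>R 1 - star z * z)"
    by (intro positive_norm_minus) (simp_all add: star_simps)
  then have 2: "positive_element ((1 + \<eta>) *\<^sub>R ((1 + \<eta>)\<^sup>2 *\<^sub>R 1 - star z * z))"
    using \<eta> by (intro positive_scaleR) auto
  have "(1 + \<eta>) * (1 + \<eta>)\<^sup>2 = 1 + \<eta> * (3 + 3 * \<eta> + \<eta> * \<eta>)"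
    by (simp add: power2_eq_square algebra_simps)
  also have "\<dots> \<le> 1 + \<eta> * 7"
  proof -
    have "\<eta> * \<eta> \<le> 1" using \<eta> by (simp add: mult_le_one)
    then show ?thesis using \<eta> by (intro add_left_mono mult_left_mono) auto
  qed
  finally have "(1 + \<eta>) * (1 + \<eta>)\<^sup>2 \<le> 1 + \<kappa>" using \<eta> by simp
  then have 3: "positive_element (((1 + \<kappa>) - (1 + \<eta>) * (1 + \<eta>)\<^sup>2) *\<^sub>R 1)"
    by (intro positive_scaleR) auto
  have "positive_element (j - star b * b + (1 + \<kappa>) *\<^sub>R 1)"
    using positive_add[OF positive_add[OF 1 2] 3]
    by (simp add: scaleR_diff_right scaleR_diff_left)
  then have "positive_element ((1 + \<kappa>) *\<^sub>R 1 + j - star b * b)"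
    by (simp add: algebra_simps)
  moreover have "j \<in> J" "positive_element j"
    using x \<eta> by (simp_all add: j_def ideal_scaleR[OF J] ideal_mult_left[OF J] positive_scaleR
        positive_star_mult_self)
  ultimately show ?thesis by (intro that)
qed

text \<open>
  Removes the \<open>\<kappa>\<close> from the previous bound. The witness is the positive part \<open>f\<close> of \<open>a - 1\<close>, where
  \<open>a = b\<^sup>* b\<close>, and what needs proof is \<open>f \<in> J\<close>. Since \<open>f a f = f\<^sup>2 + f\<^sup>3\<close>, compressing \<open>a \<le> 1 + \<kappa> + j\<close> by \<open>f\<close>
  gives \<open>f\<^sup>3 \<le> \<kappa> f\<^sup>2 + f j f\<close> with \<open>\<kappa>\<close> arbitrarily small, so \<open>\<surd>f f\<close> lies in \<open>J\<close>; then so do \<open>f\<^sup>4\<close>, \<open>f\<^sup>2\<close> and \<open>f\<close>.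
\<close>

lemma ideal_excess:
  fixes b :: "'a::unital_cstar_algebra"
  assumes J: "closed_two_sided_ideal J"
    and b: "\<And>\<epsilon>. \<epsilon> > 0 \<Longrightarrow> \<exists>x\<in>J. norm (b + x) \<le> 1 + \<epsilon>"
  obtains f where "f \<in> J" "positive_element f" "positive_element (1 + f - star b * b)"
proof -
  have "star (star b * b - 1) = star b * b - 1" by (simp add: star_simps)
  then obtain f g where fg: "positive_element f" "positive_element g" "f * g = 0" "g * f = 0" "star b * b - 1 = f - g"
    using positive_negative_parts by blast
  have a: "star b * b = 1 + f - g" using fg(5) by (simp add: algebra_simps)
  have sf: "star f = f" using fg by (simp add: positive_star)
  obtain m where m: "positive_element m" "m * m = f" "m * f = f * m"
    using positive_sqrt_commuting[OF fg(1) refl] .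
  define N where "N = norm (f * f)"
  have N: "N \<ge> 0" by (simp add: N_def)
  have "m * f \<in> J"
  proof (rule ideal_mem_of_square_le[OF J])
    fix \<epsilon> :: real assume \<epsilon>: "\<epsilon> > 0"
    define \<kappa> where "\<kappa> = \<epsilon> / (N + 1)"
    have \<kappa>: "\<kappa> > 0" "\<kappa> * N \<le> \<epsilon>" using \<epsilon> N by (simp_all add: \<kappa>_def field_simps)
    obtain j where j: "j \<in> J" "positive_element j" "positive_element ((1 + \<kappa>) *\<^sub>R 1 + j - star b * b)"
      using quotient_norm_square_bound[OF J b \<kappa>(1)] by blast
    have sq: "star (m * f) * (m * f) = f * f * f"
      using m by (simp add: star_simps sf positive_star) (metis mult.assoc)
    have "positive_element (star f * ((1 + \<kappa>) *\<^sub>R 1 + j - star b * b) * f)"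
      by (rule positive_conjugate[OF j(3)])
    also have "star f * ((1 + \<kappa>) *\<^sub>R 1 + j - star b * b) * f = \<kappa> *\<^sub>R (f * f) + f * j * f - f * f * f"
      using fg(3) by (simp add: a sf algebra_simps)
    finally have 1: "positive_element (\<kappa> *\<^sub>R (f * f) + f * j * f - f * f * f)" .
    have "positive_element (N *\<^sub>R 1 - f * f)"
      by (rule positive_norm_minus) (simp_all add: N_def star_simps sf)
    then have 2: "positive_element (\<kappa> *\<^sub>R (N *\<^sub>R 1 - f * f))" using \<kappa> by (intro positive_scaleR) auto
    have 3: "positive_element ((\<epsilon> - \<kappa> * N) *\<^sub>R 1)" using \<kappa> by (intro positive_scaleR) auto
    have "positive_element (f * j * f - f * f * f + \<epsilon> *\<^sub>R 1)"
      using positive_add[OF positive_add[OF 1 2] 3]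
      by (simp add: scaleR_diff_right scaleR_diff_left)
    then have "positive_element (\<epsilon> *\<^sub>R 1 + f * j * f - f * f * f)"
      by (simp add: algebra_simps)
    moreover have "positive_element (f * j * f)" using positive_conjugate[OF j(2), of f] by (simp add: sf)
    moreover have "f * j * f \<in> J" using j by (simp add: ideal_mult_left[OF J] ideal_mult_right[OF J])
    ultimately show "\<exists>j\<in>J. positive_element j \<and> positive_element (\<epsilon> *\<^sub>R 1 + j - star (m * f) * (m * f))"
      unfolding sq by blast
  qed
  then have "f * (m * (m * f)) \<in> J" by (simp add: ideal_mult_left[OF J])
  then have "star (f * f) * (f * f) \<in> J"
    using ideal_mult_left[OF J, of _ f] by (simp add: star_simps sf mult.assoc m(2) flip: mult.assoc[of m m])
  then have "star f * f \<in> J" using ideal_mem_of_square_mem[OF J, of "f * f"] by (simp add: sf)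
  then have "f \<in> J" by (rule ideal_mem_of_square_mem[OF J])
  moreover have "1 + f - star b * b = g" by (simp add: a)
  ultimately show ?thesis using fg that by metis
qed

section \<open>Stein inequalities for commuting families\<close>

text \<open>
  The solution \<open>p\<close> of the Stein equation \<open>p - b\<^sup>* p b = y\<close>.
\<close>

definition stein_sum :: "'a::unital_cstar_algebra \<Rightarrow> 'a \<Rightarrow> 'a" where
  "stein_sum b y = (\<Sum>n. star (b ^ n) * y * b ^ n)"

context
  fixes b :: "'a::unital_cstar_algebra"
  assumes b: "summable (\<lambda>n. (norm (b ^ n))\<^sup>2)"
begin

lemma stein_sum_summable: "summable (\<lambda>n. star (b ^ n) * y * b ^ n)"
proof (rule summable_norm_cancel, rule summable_comparison_test')
  show "summable (\<lambda>n. norm y * (norm (b ^ n))\<^sup>2)" using b by (rule summable_mult)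
  show "norm (norm (star (b ^ n) * y * b ^ n)) \<le> norm y * (norm (b ^ n))\<^sup>2" for n
  proof -
    have "norm (star (b ^ n) * y * b ^ n) \<le> norm (star (b ^ n) * y) * norm (b ^ n)"
      by (rule norm_mult_ineq)
    also have "\<dots> \<le> (norm (b ^ n) * norm y) * norm (b ^ n)"
      using norm_mult_ineq[of "star (b ^ n)" y] by (intro mult_right_mono) auto
    finally show ?thesis by (simp add: power2_eq_square mult.commute mult.left_commute)
  qed
qed

lemma stein_sum_sums: "(\<lambda>n. star (b ^ n) * y * b ^ n) sums stein_sum b y"
  unfolding stein_sum_def by (rule summable_sums[OF stein_sum_summable])

lemma stein_sum_diff: "stein_sum b (x - y) = stein_sum b x - stein_sum b y"
  using suminf_diff[OF stein_sum_summable stein_sum_summable, of x y]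
  by (simp add: stein_sum_def left_diff_distrib right_diff_distrib)

lemma stein_sum_conjugate:
  assumes "b * c = c * b"
  shows "stein_sum b (star c * y * c) = star c * stein_sum b y * c"
proof -
  have comm: "b ^ n * c = c * b ^ n" for n
    using assms by (metis power_commuting_commutes)
  have "star (b ^ n) * (star c * y * c) * b ^ n = star c * (star (b ^ n) * y * b ^ n) * c" for n
  proof -
    have "star (b ^ n) * (star c * y * c) * b ^ n = star (c * b ^ n) * y * (c * b ^ n)"
      by (simp add: star_simps mult.assoc)
    also have "\<dots> = star (b ^ n * c) * y * (b ^ n * c)" by (simp add: comm)
    finally show ?thesis by (simp add: star_simps mult.assoc)
  qed
  moreover have "(\<lambda>n. star c * (star (b ^ n) * y * b ^ n) * c) sums (star c * stein_sum b y * c)"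
    by (intro sums_mult sums_mult2 stein_sum_sums)
  ultimately show ?thesis using stein_sum_sums[of "star c * y * c"] by (simp add: sums_unique2)
qed

lemma stein_sum_equation: "stein_sum b y - star b * stein_sum b y * b = y"
proof -
  have "star (b ^ n) * (star b * y * b) * b ^ n = star (b ^ Suc n) * y * b ^ Suc n" for n
    by (simp add: star_simps mult.assoc)
  then have "star b * stein_sum b y * b = (\<Sum>n. star (b ^ Suc n) * y * b ^ Suc n)"
    unfolding stein_sum_conjugate[OF refl, symmetric] by (simp add: stein_sum_def)
  also have "\<dots> = stein_sum b y - y"
    using suminf_split_head[OF stein_sum_summable[of y]] by (simp add: stein_sum_def)
  finally show ?thesis by simp
qed

lemma stein_sum_positive: "positive_element y \<Longrightarrow> positive_element (stein_sum b y)"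
  by (rule positive_tendsto[OF _ stein_sum_sums[of y, unfolded sums_def]])
    (intro positive_sum positive_conjugate)

lemma stein_sum_ge: "positive_element y \<Longrightarrow> positive_element (stein_sum b y - y)"
  using stein_sum_equation[of y] positive_conjugate[OF stein_sum_positive, of y b]
  by (metis add_diff_cancel_left' diff_add_cancel)

lemma stein_sum_ideal: "closed_two_sided_ideal J \<Longrightarrow> y \<in> J \<Longrightarrow> stein_sum b y \<in> J"
  by (rule closed_sequentially[OF ideal_closed _ stein_sum_sums[of y, unfolded sums_def]])
    (simp_all add: ideal_sum ideal_mult_left ideal_mult_right)

end

text \<open>
  Induction over the family, applying the map \<open>T = stein_sum (b i)\<close> of the new element \<open>b i\<close> to the
  solution \<open>p\<close> for the others. For \<open>b i\<close> itself the Stein equation returns \<open>p \<ge> f\<close>. For an old \<open>b j\<close>,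
  commutativity gives \<open>T p - b\<^sub>j\<^sup>* (T p) b\<^sub>j = T (p - b\<^sub>j\<^sup>* p b\<^sub>j)\<close>, and \<open>T q \<ge> q \<ge> f\<close> whenever \<open>q \<ge> f\<close>.
\<close>

lemma simultaneous_stein_inequality:
  fixes b :: "'i \<Rightarrow> 'a::unital_cstar_algebra"
  assumes J: "closed_two_sided_ideal J" and f: "f \<in> J" "positive_element f"
    and "finite F"
    and "\<And>i. i \<in> F \<Longrightarrow> summable (\<lambda>n. (norm (b i ^ n))\<^sup>2)"
    and "\<And>i j. i \<in> F \<Longrightarrow> j \<in> F \<Longrightarrow> b i * b j = b j * b i"
  shows "\<exists>p\<in>J. positive_element (p - f) \<and> (\<forall>j\<in>F. positive_element (p - star (b j) * p * b j - f))"
  using assms(4-6)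
proof (induction F rule: finite_induct)
  case empty
  show ?case using f by (auto intro!: bexI[of _ f])
next
  case (insert i F)
  then obtain p where p: "p \<in> J" "positive_element (p - f)"
    "\<And>j. j \<in> F \<Longrightarrow> positive_element (p - star (b j) * p * b j - f)"
    by (metis (no_types, lifting) insertCI)
  have s: "summable (\<lambda>n. (norm (b i ^ n))\<^sup>2)" using insert.prems by simp
  let ?T = "stein_sum (b i)"
  have ge: "positive_element (?T q - f)" if "positive_element (q - f)" for q
  proof -
    have "positive_element q" using positive_add[OF that f(2)] by simp
    then have "positive_element (?T q - q)" by (rule stein_sum_ge[OF s])
    then show ?thesis using positive_add[OF _ that, of "?T q - q"] by simp
  qed
  have "positive_element (?T p - star (b j) * ?T p * b j - f)" if "j \<in> insert i F" for j
  proof (cases "j = i")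
    case True
    then show ?thesis using stein_sum_equation[OF s, of p] p by simp
  next
    case False
    then have j: "j \<in> F" using that by simp
    then have "b i * b j = b j * b i" using insert.prems by simp
    then have "?T p - star (b j) * ?T p * b j = ?T (p - star (b j) * p * b j)"
      by (simp add: stein_sum_diff[OF s] stein_sum_conjugate[OF s])
    then show ?thesis using ge p(3)[OF j] by simp
  qed
  then show ?case using ge[OF p(2)] stein_sum_ideal[OF s J p(1)] by blast
qed

lemma simultaneous_contraction_weight:
  fixes b :: "'i \<Rightarrow> 'a::unital_cstar_algebra"
  assumes J: "closed_two_sided_ideal J" and "finite F"
    and "\<And>i. i \<in> F \<Longrightarrow> summable (\<lambda>n. (norm (b i ^ n))\<^sup>2)"
    and "\<And>i j. i \<in> F \<Longrightarrow> j \<in> F \<Longrightarrow> b i * b j = b j * b i"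
    and "\<And>i \<epsilon>. i \<in> F \<Longrightarrow> \<epsilon> > 0 \<Longrightarrow> \<exists>x\<in>J. norm (b i + x) \<le> 1 + \<epsilon>"
  obtains p where "p \<in> J" "positive_element p"
    "\<And>i. i \<in> F \<Longrightarrow> positive_element ((1 + p) - star (b i) * (1 + p) * b i)"
proof -
  have "\<forall>i\<in>F. \<exists>f. f \<in> J \<and> positive_element f \<and> positive_element (1 + f - star (b i) * b i)"
    using ideal_excess[OF J] assms(5) by metis
  then obtain f where f: "\<And>i. i \<in> F \<Longrightarrow> f i \<in> J" "\<And>i. i \<in> F \<Longrightarrow> positive_element (f i)"
    "\<And>i. i \<in> F \<Longrightarrow> positive_element (1 + f i - star (b i) * b i)" by metis
  define g where "g = sum f F"
  have g: "g \<in> J" "positive_element g" using f by (auto simp: g_def intro!: ideal_sum[OF J] positive_sum)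
  have gf: "positive_element (1 + g - star (b i) * b i)" if "i \<in> F" for i
  proof -
    have "g = f i + sum f (F - {i})" unfolding g_def using assms(2) that by (rule sum.remove)
    moreover have "positive_element (sum f (F - {i}))" using f by (intro positive_sum) auto
    ultimately show ?thesis
      using positive_add[OF f(3)[OF that], of "sum f (F - {i})"] by (simp add: algebra_simps)
  qed
  obtain p where p: "p \<in> J" "positive_element (p - g)"
    "\<And>i. i \<in> F \<Longrightarrow> positive_element (p - star (b i) * p * b i - g)"
    using simultaneous_stein_inequality[OF J g assms(2), of b] assms(3,4) by blast
  have "positive_element ((1 + p) - star (b i) * (1 + p) * b i)" if "i \<in> F" for i
    using positive_add[OF gf[OF that] p(3)[OF that]] by (simp add: algebra_simps)
  moreover have "positive_element p" using positive_add[OF p(2) g(2)] by simp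
  ultimately show ?thesis using p(1) that by blast
qed

text \<open>
  For \<open>x = h b h\<^sup>-\<^sup>1\<close>, the element \<open>1 - x\<^sup>* x\<close> is the assumed difference compressed by \<open>h\<^sup>-\<^sup>1\<close>.
\<close>

lemma norm_conjugate_le_one:
  fixes h :: "'a::unital_cstar_algebra"
  assumes h: "star h = h" "h * k = 1" "k * h = 1"
    and le: "positive_element (h * h - star b * (h * h) * b)"
  shows "norm (h * b * k) \<le> 1"
proof -
  have k: "star k = k"
  proof -
    have "star k * h = 1" using star_mult[of h k] h by simp
    then show ?thesis by (metis h(2) mult.assoc mult_1 mult_1_right)
  qed
  have "star k * (h * h) * k = (k * h) * (h * k)" by (simp only: k mult.assoc)
  then have hh: "star k * (h * h) * k = 1" by (simp add: h)
  have "positive_element (star k * (h * h - star b * (h * h) * b) * k)"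
    by (rule positive_conjugate[OF le])
  also have "star k * (h * h - star b * (h * h) * b) * k
      = star k * (h * h) * k - star (h * b * k) * (h * b * k)"
    by (simp add: left_diff_distrib right_diff_distrib star_simps h k mult.assoc)
  finally have "positive_element (1 - star (h * b * k) * (h * b * k))" unfolding hh .
  then have "norm (star (h * b * k) * (h * b * k)) \<le> 1"
    using positive_add_eq_one[OF positive_star_mult_self[of "h * b * k"]] by simp
  then show ?thesis by (simp add: cstar_identity abs_square_le_1)
qed

section \<open>Growth of powers and the spectrum\<close>

lemma sum_powers_root_of_unity:
  assumes "0 < m" "m < n"
  shows "(\<Sum>k<n. (cis (2 * pi / real n) ^ k) ^ m) = 0"
proof -
  let ?w = "cis (2 * pi / real n)"
  have n: "n > 0" using assms by simp
  have "?w ^ m \<noteq> 1"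
  proof
    assume "?w ^ m = 1"
    then have "cis (2 * pi * real m / real n) = cis (2 * pi * real 0 / real n)"
      by (simp add: Complex.DeMoivre mult.commute)
    then have "m = 0"
      using inj_onD[OF bij_betw_imp_inj_on[OF Complex.bij_betw_roots_unity[OF n]], of m 0] assms by simp
    then show False using assms by simp
  qed
  moreover have "(?w ^ m) ^ n = 1"
  proof -
    have "?w ^ n = 1" using n by (simp add: Complex.DeMoivre)
    then show ?thesis by (simp flip: power_mult add: mult.commute[of m]) (simp add: power_mult)
  qed
  moreover have "(\<Sum>k<n. (?w ^ k) ^ m) = (\<Sum>k<n. (?w ^ m) ^ k)"
    by (simp add: mult.commute flip: power_mult)
  ultimately show ?thesis by (simp add: geometric_sum)
qed

lemma sum_powers_telescope:
  fixes x :: "'a::ring_1"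
  shows "(\<Sum>m<n. x ^ m) * (1 - x) = 1 - x ^ n"
proof (induction n)
  case (Suc n)
  have "(\<Sum>m<Suc n. x ^ m) * (1 - x) = (\<Sum>m<n. x ^ m) * (1 - x) + x ^ n * (1 - x)"
    by (simp add: distrib_right)
  also have "\<dots> = 1 - x ^ n + (x ^ n - x ^ Suc n)"
    unfolding Suc by (simp add: right_diff_distrib power_commutes)
  finally show ?case by simp
qed simp

text \<open>
  The resolvent identity \<open>Y z - Y w = (z - w) Y z b Y w\<close> first shows that \<open>Y\<close> is locally bounded and
  continuous, then, with a bound from compactness of the disc, that it is Lipschitz.
\<close>

lemma resolvent_lipschitz:
  fixes b :: "'a::unital_cstar_algebra" and Y :: "complex \<Rightarrow> 'a"
  assumes Y: "\<And>z. cmod z \<le> R \<Longrightarrow> Y z * (1 - z *\<^sub>C b) = 1"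
    "\<And>z. cmod z \<le> R \<Longrightarrow> (1 - z *\<^sub>C b) * Y z = 1"
  obtains K L where "K \<ge> 0" "L \<ge> 0" "\<And>z. cmod z \<le> R \<Longrightarrow> norm (Y z) \<le> K"
    "\<And>z w. cmod z \<le> R \<Longrightarrow> cmod w \<le> R \<Longrightarrow> norm (Y z - Y w) \<le> L * cmod (z - w)"
proof -
  define B where "B = norm b"
  have identity: "Y z - Y w = (z - w) *\<^sub>C (Y z * b * Y w)" if zw: "cmod z \<le> R" "cmod w \<le> R" for z w
  proof -
    have "Y z - Y w = Y z * ((1 - w *\<^sub>C b) * Y w) - (Y z * (1 - z *\<^sub>C b)) * Y w"
      by (simp add: Y zw)
    also have "\<dots> = Y z * ((1 - w *\<^sub>C b) - (1 - z *\<^sub>C b)) * Y w"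
      by (simp add: left_diff_distrib right_diff_distrib mult.assoc)
    also have "(1 - w *\<^sub>C b) - (1 - z *\<^sub>C b) = (z - w) *\<^sub>C b" by (simp add: scaleC_diff_left)
    finally show ?thesis by (simp add: mult_scaleC_left mult_scaleC_right)
  qed
  have bound: "norm (Y z - Y w) \<le> cmod (z - w) * (norm (Y z) * B * norm (Y w))"
    if zw: "cmod z \<le> R" "cmod w \<le> R" for z w
  proof -
    have "norm (Y z * b * Y w) \<le> norm (Y z * b) * norm (Y w)" by (rule norm_mult_ineq)
    also have "\<dots> \<le> norm (Y z) * B * norm (Y w)"
      unfolding B_def by (intro mult_right_mono norm_mult_ineq) simp
    finally show ?thesis unfolding identity[OF zw] norm_scaleC by (simp add: mult_left_mono)
  qed
  have "continuous_on (cball 0 R) Y"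
    unfolding continuous_on_iff
  proof (intro ballI allI impI)
    fix w :: complex and e :: real assume w: "w \<in> cball 0 R" and e: "0 < e"
    define M where "M = norm (Y w)"
    have MB: "M \<ge> 0" "B \<ge> 0" by (simp_all add: M_def B_def)
    \<comment> \<open>the first bound gives \<open>\<parallel>Y z\<parallel> \<le> 2 M\<close>, the second then makes the difference less than \<open>e\<close>\<close>
    define d where "d = min (1 / (2 * (B * M + 1))) (e / (2 * M * B * M + 1))"
    have d: "d > 0" using MB e by (simp add: d_def add_nonneg_pos)
    show "\<exists>d>0. \<forall>z\<in>cball 0 R. dist z w < d \<longrightarrow> dist (Y z) (Y w) < e"
    proof (intro exI conjI ballI impI, rule d)
      fix z assume z: "z \<in> cball 0 R" "dist z w < d"
      define t where "t = cmod (z - w)"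
      have t: "0 \<le> t" "t < 1 / (2 * (B * M + 1))" "t < e / (2 * M * B * M + 1)"
        using z by (simp_all add: t_def d_def dist_norm)
      have "0 < 2 * (B * M + 1)" using MB by (simp add: add_nonneg_pos)
      then have "t * (2 * (B * M + 1)) \<le> 1" using t(2) by (simp add: pos_less_divide_eq)
      then have half: "t * (B * M) \<le> 1 / 2" using t(1) by (simp add: algebra_simps)
      have diff: "norm (Y z - Y w) \<le> t * (norm (Y z) * B * M)"
        using bound[of z w] z w by (simp add: t_def M_def)
      have "norm (Y z) \<le> M + t * (norm (Y z) * B * M)"
        using diff norm_triangle_sub[of "Y z" "Y w"] by (simp add: M_def)
      also have "t * (norm (Y z) * B * M) = norm (Y z) * (t * (B * M))" by (simp add: ac_simps)
      also have "\<dots> \<le> norm (Y z) * (1 / 2)" using half by (intro mult_left_mono) auto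
      finally have "norm (Y z) \<le> 2 * M" by simp
      then have "t * (norm (Y z) * B * M) \<le> t * (2 * M * B * M)"
        using t MB by (intro mult_left_mono mult_right_mono) auto
      also have "\<dots> \<le> t * (2 * M * B * M + 1)" using t by (simp add: mult_left_mono)
      also have "\<dots> < e" using t(3) MB by (simp add: pos_less_divide_eq add_nonneg_pos)
      finally show "dist (Y z) (Y w) < e" using diff by (simp add: dist_norm)
    qed
  qed
  then have "bounded (Y ` cball 0 R)"
    by (intro compact_imp_bounded compact_continuous_image) auto
  then obtain K' where K': "\<And>z. cmod z \<le> R \<Longrightarrow> norm (Y z) \<le> K'"
    unfolding bounded_iff by (meson image_eqI mem_cball_0)
  define K where "K = max 0 K'"
  have K: "K \<ge> 0" "\<And>z. cmod z \<le> R \<Longrightarrow> norm (Y z) \<le> K" using K' by (auto simp: K_def le_max_iff_disj)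
  have B: "B \<ge> 0" by (simp add: B_def)
  show ?thesis
  proof (rule that)
    show "K \<ge> 0" "K * B * K \<ge> 0" using K B by auto
    show "norm (Y z) \<le> K" if "cmod z \<le> R" for z using K that by simp
    show "norm (Y z - Y w) \<le> K * B * K * cmod (z - w)" if zw: "cmod z \<le> R" "cmod w \<le> R" for z w
    proof -
      have "norm (Y z) * B * norm (Y w) \<le> K * B * K"
        using K zw B by (intro mult_mono) auto
      then have "cmod (z - w) * (norm (Y z) * B * norm (Y w)) \<le> cmod (z - w) * (K * B * K)"
        by (intro mult_left_mono) auto
      then show ?thesis using bound[OF zw] by (simp add: mult.commute)
    qed
  qed
qed

text \<open>
  Each \<open>(1 - t\<^sup>n b\<^sup>n) Y z\<close> with \<open>z\<^sup>n = t\<^sup>n\<close> is a geometric sum in \<open>z b\<close>, and averaging over the \<open>n\<close>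
  values of \<open>z\<close> leaves only its constant term.
\<close>

lemma resolvent_of_power:
  fixes b :: "'a::unital_cstar_algebra" and Y :: "complex \<Rightarrow> 'a"
  assumes Y: "\<And>z. cmod z \<le> R \<Longrightarrow> (1 - z *\<^sub>C b) * Y z = 1"
    and t: "0 \<le> t" "t \<le> R" and n: "n > 0"
  shows "(1 - t ^ n *\<^sub>R b ^ n) * ((1 / real n) *\<^sub>R (\<Sum>k<n. Y (cis (2 * pi / real n) ^ k * of_real t))) = 1"
proof -
  let ?w = "cis (2 * pi / real n)"
  let ?z = "\<lambda>k. ?w ^ k * of_real t"
  have wn: "?w ^ n = 1" using n by (simp add: Complex.DeMoivre)
  have z: "cmod (?z k) \<le> R" for k using t by (simp add: norm_mult norm_power)
  have zn: "(?z k *\<^sub>C b) ^ n = t ^ n *\<^sub>R b ^ n" for k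
  proof -
    have "(?w ^ k) ^ n = 1" using wn by (metis mult.commute power_mult power_one)
    then show ?thesis
      by (simp add: power_scaleC power_mult_distrib scaleC_of_real flip: of_real_power)
  qed
  have "(1 - t ^ n *\<^sub>R b ^ n) * Y (?z k) = (\<Sum>m<n. (?z k *\<^sub>C b) ^ m)" for k
  proof -
    have "(1 - t ^ n *\<^sub>R b ^ n) * Y (?z k) = (\<Sum>m<n. (?z k *\<^sub>C b) ^ m) * ((1 - ?z k *\<^sub>C b) * Y (?z k))"
      using sum_powers_telescope[of "?z k *\<^sub>C b" n] by (simp add: zn flip: mult.assoc)
    then show ?thesis using Y[OF z] by simp
  qed
  then have "(1 - t ^ n *\<^sub>R b ^ n) * (\<Sum>k<n. Y (?z k)) = (\<Sum>k<n. \<Sum>m<n. (?z k *\<^sub>C b) ^ m)"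
    by (simp add: sum_distrib_left)
  also have "\<dots> = (\<Sum>m<n. \<Sum>k<n. (?z k *\<^sub>C b) ^ m)" by (rule sum.swap)
  also have "\<dots> = (\<Sum>m<n. (\<Sum>k<n. (?w ^ k) ^ m) *\<^sub>C (of_real t ^ m *\<^sub>C b ^ m))"
    by (simp add: scaleC_sum_left sum_distrib_right power_scaleC power_mult_distrib scaleC_scaleC)
  also have "\<dots> = (\<Sum>m<n. if m = 0 then of_real (real n) *\<^sub>C 1 else 0)"
    using sum_powers_root_of_unity[of _ n] by (intro sum.cong) auto
  also have "\<dots> = real n *\<^sub>R 1" using n by (simp add: scaleC_of_real del: of_real_of_nat_eq)
  finally show ?thesis using n by simp
qed

text \<open>
  The averages \<open>F n t = (1 - t\<^sup>n b\<^sup>n)\<^sup>-\<^sup>1\<close> of the resolvent inherit its bound and its Lipschitz constant, for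
  all \<open>n\<close> at once. If \<open>t\<^sup>n b\<^sup>n \<longlonglongrightarrow> 0\<close>, then \<open>F n t\<close> is eventually close to \<open>1\<close>, so \<open>F n s\<close> stays near \<open>1\<close> for a
  slightly larger \<open>s\<close>, which bounds \<open>s\<^sup>n b\<^sup>n\<close>; any radius below \<open>s\<close> then inherits the convergence to \<open>0\<close>.
  The step length does not depend on \<open>t\<close>, so finitely many steps lead from \<open>0\<close> past \<open>1\<close>.
\<close>

theorem power_series_radius:
  fixes b :: "'a::unital_cstar_algebra"
  assumes R: "R > 1" and inv: "\<And>z. cmod z \<le> R \<Longrightarrow> \<exists>y. y * (1 - z *\<^sub>C b) = 1 \<and> (1 - z *\<^sub>C b) * y = 1"
  obtains r where "r > 1" "(\<lambda>n. r ^ n *\<^sub>R b ^ n) \<longlonglongrightarrow> 0"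
proof -
  obtain Y where Y: "\<And>z. cmod z \<le> R \<Longrightarrow> Y z * (1 - z *\<^sub>C b) = 1"
    "\<And>z. cmod z \<le> R \<Longrightarrow> (1 - z *\<^sub>C b) * Y z = 1"
    using inv by metis
  obtain K L where KL: "K \<ge> 0" "L \<ge> 0" "\<And>z. cmod z \<le> R \<Longrightarrow> norm (Y z) \<le> K"
    "\<And>z w. cmod z \<le> R \<Longrightarrow> cmod w \<le> R \<Longrightarrow> norm (Y z - Y w) \<le> L * cmod (z - w)"
    using resolvent_lipschitz[OF Y] by metis
  define F where "F n t = (1 / real n) *\<^sub>R (\<Sum>k<n. Y (cis (2 * pi / real n) ^ k * of_real t))" for n t
  have arg: "cmod (cis (2 * pi / real n) ^ k * of_real t) \<le> R" if "0 \<le> t" "t \<le> R" for n k t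
    using that by (simp add: norm_mult norm_power)
  have F_eq: "(1 - t ^ n *\<^sub>R b ^ n) * F n t = 1" if "0 \<le> t" "t \<le> R" "n > 0" for n t
    unfolding F_def using Y(2) that by (rule resolvent_of_power)
  have F_bound: "norm (F n t) \<le> K" if t: "0 \<le> t" "t \<le> R" and n: "n > 0" for n t
  proof -
    have "norm (\<Sum>k<n. Y (cis (2 * pi / real n) ^ k * of_real t)) \<le> (\<Sum>k<n. K)"
      by (intro sum_norm_le KL arg t)
    then show ?thesis using n by (simp add: F_def field_simps)
  qed
  have F_lip: "norm (F n s - F n t) \<le> L * (s - t)" if t: "0 \<le> t" "t \<le> s" "s \<le> R" and n: "n > 0" for n s t
  proof -
    let ?z = "\<lambda>k t. cis (2 * pi / real n) ^ k * complex_of_real t"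
    have "norm (\<Sum>k<n. Y (?z k s) - Y (?z k t)) \<le> (\<Sum>k<n. L * (s - t))"
    proof (rule sum_norm_le)
      fix k
      have "norm (Y (?z k s) - Y (?z k t)) \<le> L * cmod (?z k s - ?z k t)"
        using t by (intro KL arg) auto
      also have "?z k s - ?z k t = ?z k (s - t)" by (simp add: right_diff_distrib)
      also have "cmod (?z k (s - t)) = s - t" using t by (simp only: norm_mult norm_power norm_cis norm_of_real power_one) simp
      finally show "norm (Y (?z k s) - Y (?z k t)) \<le> L * (s - t)" .
    qed
    moreover have "F n s - F n t = (1 / real n) *\<^sub>R (\<Sum>k<n. Y (?z k s) - Y (?z k t))"
      by (simp add: F_def sum_subtractf scaleR_diff_right)
    ultimately show ?thesis using n by (simp add: field_simps)
  qed
  \<comment> \<open>\<open>M\<close> steps of length \<open>\<delta> = R / M\<close>: over two steps the averages change by at most \<open>1 / 4\<close>, and the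
    radius \<open>R - \<delta>\<close> still exceeds \<open>1\<close>\<close>
  obtain M :: nat where M: "real M > max (8 * L * R) (R / (R - 1))" using reals_Archimedean2 by blast
  define \<delta> where "\<delta> = R / real M"
  have M0: "real M > 0" using M R by (smt (verit) divide_pos_pos max_less_iff_conj)
  have \<delta>: "\<delta> > 0" using R M0 by (simp add: \<delta>_def)
  have L\<delta>: "L * (2 * \<delta>) \<le> 1 / 4" using M M0 by (simp add: \<delta>_def field_simps)
  have M\<delta>: "real M * \<delta> = R" using M0 by (simp add: \<delta>_def)
  have step: "(\<lambda>n. (real m * \<delta>) ^ n *\<^sub>R b ^ n) \<longlonglongrightarrow> 0" if "m < M" for m
    using that
  proof (induction m)
    case 0
    show ?case
      by (rule tendsto_eventually) (auto simp: eventually_sequentially intro!: exI[of _ 1])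
  next
    case (Suc m)
    define t where "t = real m * \<delta>"
    define s where "s = real (m + 2) * \<delta>"
    have s0: "0 < s" using \<delta> by (simp add: s_def)
    have st: "0 \<le> t" "t \<le> s" "s - t = 2 * \<delta>"
      using \<delta> by (simp_all add: t_def s_def algebra_simps)
    have "s \<le> real M * \<delta>" unfolding s_def using Suc.prems \<delta> by (intro mult_right_mono) auto
    then have sR: "s \<le> R" "t \<le> R" using M\<delta> st by auto
    have "(\<lambda>n. t ^ n *\<^sub>R b ^ n) \<longlonglongrightarrow> 0" using Suc by (simp add: t_def)
    then have "\<forall>\<^sub>F n in sequentially. norm (t ^ n *\<^sub>R b ^ n) < 1 / (4 * (K + 1))"
      using KL(1) by (intro order_tendstoD(2)[OF tendsto_norm_zero]) auto
    then have "\<forall>\<^sub>F n in sequentially. norm (s ^ n *\<^sub>R b ^ n) \<le> 1"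
      using eventually_gt_at_top[of 0]
    proof eventually_elim
      case (elim n)
      let ?c = "t ^ n *\<^sub>R b ^ n" and ?d = "s ^ n *\<^sub>R b ^ n"
      have cF: "F n t - ?c * F n t = 1"
        using F_eq[of t n] st sR elim by (simp add: left_diff_distrib)
      have "norm (?c * F n t) \<le> norm ?c * norm (F n t)" by (rule norm_mult_ineq)
      also have "\<dots> \<le> 1 / (4 * (K + 1)) * K"
        using elim F_bound[of t n] st sR KL by (intro mult_mono) auto
      also have "\<dots> \<le> 1 / 4" using KL by (simp add: field_simps)
      also have "?c * F n t = F n t - 1" unfolding cF[symmetric] by simp
      finally have "norm (F n t - 1) \<le> 1 / 4" .
      moreover have "norm (F n s - F n t) \<le> 1 / 4"
        using F_lip[of t s n] st sR elim L\<delta> by simp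
      ultimately have half: "norm (F n s - 1) \<le> 1 / 2"
        using norm_triangle_ineq[of "F n s - F n t" "F n t - 1"] by simp
      have dF: "F n s - ?d * F n s = 1"
        using F_eq[of s n] st sR elim by (simp add: left_diff_distrib)
      then have "?d = (F n s - 1) - ?d * (F n s - 1)" by (simp add: algebra_simps)
      then have "norm ?d \<le> norm (F n s - 1) + norm (?d * (F n s - 1))"
        using norm_triangle_ineq4[of "F n s - 1" "?d * (F n s - 1)"] by metis
      also have "norm (?d * (F n s - 1)) \<le> norm ?d * (1 / 2)"
        using norm_mult_ineq[of ?d "F n s - 1"] mult_left_mono[OF half norm_ge_zero, of ?d] by linarith
      finally show ?case using half by simp
    qed
    then have "\<forall>\<^sub>F n in sequentially.
        norm ((real (Suc m) * \<delta>) ^ n *\<^sub>R b ^ n) \<le> (real (Suc m) / real (m + 2)) ^ n"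
    proof eventually_elim
      case (elim n)
      define q where "q = real (Suc m) / real (m + 2)"
      have q: "q \<ge> 0" by (simp add: q_def)
      have "real (Suc m) * \<delta> = q * s" by (simp add: s_def q_def)
      then have "(real (Suc m) * \<delta>) ^ n *\<^sub>R b ^ n = q ^ n *\<^sub>R (s ^ n *\<^sub>R b ^ n)"
        by (simp only: power_mult_distrib scaleR_scaleR)
      then have "norm ((real (Suc m) * \<delta>) ^ n *\<^sub>R b ^ n) = q ^ n * norm (s ^ n *\<^sub>R b ^ n)"
        using q by (simp only: norm_scaleR[of "q ^ n"]) simp
      also have "\<dots> \<le> q ^ n * 1" using q elim by (intro mult_left_mono) simp_all
      finally show ?case by (simp only: q_def mult_1_right)
    qed
    moreover have "(\<lambda>n. (real (Suc m) / real (m + 2)) ^ n) \<longlonglongrightarrow> 0"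
      by (rule LIMSEQ_power_zero) simp
    ultimately show ?case by (rule Lim_null_comparison)
  qed
  have "M > 0" using M0 by simp
  then have "(real (M - 1)) * \<delta> = R - \<delta>" using M\<delta> by (simp add: of_nat_diff algebra_simps)
  moreover have "\<delta> < R - 1" using M R M0 by (simp add: \<delta>_def field_simps)
  ultimately have "real (M - 1) * \<delta> > 1" by linarith
  with step[of "M - 1"] \<open>M > 0\<close> show ?thesis by (intro that) auto
qed

corollary summable_norm_power_square:
  fixes b :: "'a::unital_cstar_algebra"
  assumes "R > 1" "\<And>z. cmod z \<le> R \<Longrightarrow> \<exists>y. y * (1 - z *\<^sub>C b) = 1 \<and> (1 - z *\<^sub>C b) * y = 1"
  shows "summable (\<lambda>n. (norm (b ^ n))\<^sup>2)"
proof -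
  obtain r where r: "r > 1" "(\<lambda>n. r ^ n *\<^sub>R b ^ n) \<longlonglongrightarrow> 0"
    using power_series_radius[of R b] assms by blast
  then obtain C where C: "\<And>n. norm (r ^ n *\<^sub>R b ^ n) \<le> C"
    using convergent_imp_Bseq[of "\<lambda>n. r ^ n *\<^sub>R b ^ n"] unfolding convergent_def Bseq_def by blast
  show ?thesis
  proof (rule summable_comparison_test')
    show "summable (\<lambda>n. C\<^sup>2 * (1 / r\<^sup>2) ^ n)"
      using r by (intro summable_mult summable_geometric) simp
    show "norm ((norm (b ^ n))\<^sup>2) \<le> C\<^sup>2 * (1 / r\<^sup>2) ^ n" for n
    proof -
      have "(r ^ n * norm (b ^ n))\<^sup>2 \<le> C\<^sup>2" using C[of n] r by (intro power_mono) auto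
      then show ?thesis using r
        by (simp add: power_mult_distrib power_divide field_simps flip: power_mult)
    qed
  qed
qed

section \<open>Adjoining a unit\<close>

text \<open>
  The algebra \<open>A \<oplus> \<complex>\<close>. Its norm will be the maximum of the modulus of the scalar part and the
  operator norm of the action on \<open>A\<close> by left multiplication. The maximum is what makes this a norm also
  for unital \<open>A\<close>, on which the difference of the two units acts as \<open>0\<close>.
\<close>

datatype 'a with_unit = Adjoin (element_part: 'a) (scalar_part: complex)

lemma with_unit_eq_iff: "x = y \<longleftrightarrow> element_part x = element_part y \<and> scalar_part x = scalar_part y"
  by (cases x; cases y) simp

definition left_action :: "'a::cstar_algebra with_unit \<Rightarrow> 'a \<Rightarrow> 'a" where
  "left_action x y = element_part x * y + scalar_part x *\<^sub>C y"

lemma bounded_linear_scaleC: "bounded_linear (\<lambda>y::'a::cstar_algebra. c *\<^sub>C y)"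
proof (rule bounded_linear_intro[where K = "cmod c"])
  show "c *\<^sub>C (r *\<^sub>R x) = r *\<^sub>R c *\<^sub>C x" for r and x :: 'a
    by (simp add: scaleC_scaleC mult.commute flip: scaleC_of_real)
qed (simp_all add: scaleC_add_right norm_scaleC mult.commute)

lemma bounded_linear_left_action: "bounded_linear (left_action x)"
  unfolding left_action_def[abs_def]
  by (intro bounded_linear_add bounded_linear_mult_right bounded_linear_scaleC)

definition action_norm :: "'a::cstar_algebra with_unit \<Rightarrow> real" where
  "action_norm x = onorm (left_action x)"

lemma action_norm_bound: "norm (left_action x y) \<le> action_norm x * norm y"
  unfolding action_norm_def by (rule onorm[OF bounded_linear_left_action])

lemma action_norm_nonneg [simp]: "0 \<le> action_norm x"
  unfolding action_norm_def by (rule onorm_pos_le[OF bounded_linear_left_action])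

lemma action_norm_le: "0 \<le> c \<Longrightarrow> (\<And>y. norm (left_action x y) \<le> c * norm y) \<Longrightarrow> action_norm x \<le> c"
  unfolding action_norm_def by (rule onorm_bound)

instantiation with_unit :: (cstar_algebra) real_normed_algebra_1
begin

definition zero_with_unit :: "'a with_unit" where "0 = Adjoin 0 0"
definition one_with_unit :: "'a with_unit" where "1 = Adjoin 0 1"
definition plus_with_unit :: "'a with_unit \<Rightarrow> 'a with_unit \<Rightarrow> 'a with_unit" where
  "x + y = Adjoin (element_part x + element_part y) (scalar_part x + scalar_part y)"
definition minus_with_unit :: "'a with_unit \<Rightarrow> 'a with_unit \<Rightarrow> 'a with_unit" where
  "x - y = Adjoin (element_part x - element_part y) (scalar_part x - scalar_part y)"
definition uminus_with_unit :: "'a with_unit \<Rightarrow> 'a with_unit" where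
  "- x = Adjoin (- element_part x) (- scalar_part x)"
definition times_with_unit :: "'a with_unit \<Rightarrow> 'a with_unit \<Rightarrow> 'a with_unit" where
  "x * y = Adjoin (element_part x * element_part y + scalar_part x *\<^sub>C element_part y
      + scalar_part y *\<^sub>C element_part x) (scalar_part x * scalar_part y)"
definition scaleR_with_unit :: "real \<Rightarrow> 'a with_unit \<Rightarrow> 'a with_unit" where
  "r *\<^sub>R x = Adjoin (r *\<^sub>R element_part x) (r *\<^sub>R scalar_part x)"
definition norm_with_unit :: "'a with_unit \<Rightarrow> real" where
  "norm x = max (cmod (scalar_part x)) (action_norm x)"
definition dist_with_unit :: "'a with_unit \<Rightarrow> 'a with_unit \<Rightarrow> real" where
  "dist_with_unit x y = norm (x - y)"
definition sgn_with_unit :: "'a with_unit \<Rightarrow> 'a with_unit" where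
  "sgn_with_unit x = inverse (norm x) *\<^sub>R x"
definition uniformity_with_unit :: "('a with_unit \<times> 'a with_unit) filter" where
  "uniformity_with_unit = (INF e\<in>{0 <..}. principal {(x, y). dist x y < e})"
definition open_with_unit :: "'a with_unit set \<Rightarrow> bool" where
  "open_with_unit U \<longleftrightarrow> (\<forall>x\<in>U. eventually (\<lambda>(x', y). x' = x \<longrightarrow> y \<in> U) uniformity)"

lemmas with_unit_ops = zero_with_unit_def one_with_unit_def plus_with_unit_def minus_with_unit_def
  uminus_with_unit_def times_with_unit_def scaleR_with_unit_def

lemma left_action_add: "left_action (x + y) z = left_action x z + left_action y z"
  by (simp add: left_action_def plus_with_unit_def distrib_right scaleC_add_left)

lemma left_action_mult: "left_action (x * y) z = left_action x (left_action y z)"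
  by (simp add: left_action_def times_with_unit_def distrib_right distrib_left scaleC_add_right
      scaleC_scaleC mult_scaleC_left mult_scaleC_right mult.assoc)

lemma action_norm_mult: "action_norm (x * y) \<le> action_norm x * action_norm y"
proof (rule action_norm_le)
  fix u
  have "norm (left_action (x * y) u) \<le> action_norm x * norm (left_action y u)"
    unfolding left_action_mult by (rule action_norm_bound)
  also have "\<dots> \<le> action_norm x * (action_norm y * norm u)"
    by (intro mult_left_mono action_norm_bound) simp
  finally show "norm (left_action (x * y) u) \<le> action_norm x * action_norm y * norm u"
    by (simp add: mult.assoc)
qed simp

lemma left_action_scaleR: "left_action (r *\<^sub>R x) z = r *\<^sub>R left_action x z"
  by (simp add: left_action_def scaleR_with_unit_def scaleC_add_right mult_scaleC_left scaleC_scaleC scaleR_conv_of_real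
      flip: scaleC_of_real)

lemma action_norm_eq_0D: "action_norm (Adjoin a 0) = 0 \<Longrightarrow> a = 0"
proof -
  assume "action_norm (Adjoin a 0) = 0"
  then have "a * star a = 0"
    using action_norm_bound[of "Adjoin a 0" "star a"] by (simp add: left_action_def)
  then have "norm (star a) = 0" using cstar_identity[of "star a"] by (simp add: star_star)
  then show ?thesis by simp
qed

instance
proof
  fix x y z :: "'a with_unit" and r s :: real
  show "x * y * z = x * (y * z)"
    by (simp add: with_unit_ops algebra_simps mult_scaleC_left mult_scaleC_right scaleC_scaleC
        scaleC_add_right)
  show "(x + y) * z = x * z + y * z" "x * (y + z) = x * y + x * z"
    by (simp_all add: with_unit_ops algebra_simps scaleC_add_right scaleC_add_left)
  show "r *\<^sub>R x * y = r *\<^sub>R (x * y)" "x * r *\<^sub>R y = r *\<^sub>R (x * y)"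
    by (simp_all add: with_unit_ops scaleC_add_right mult_scaleC_left mult_scaleC_right scaleC_scaleC
        scaleR_conv_of_real ac_simps flip: scaleC_of_real)
  show "dist x y = norm (x - y)" by (rule dist_with_unit_def)
  show "sgn x = inverse (norm x) *\<^sub>R x" by (rule sgn_with_unit_def)
  show "uniformity = (INF e\<in>{0 <..}. principal {(x, y). dist (x::'a with_unit) y < e})"
    by (rule uniformity_with_unit_def)
  show "open U \<longleftrightarrow> (\<forall>x\<in>U. \<forall>\<^sub>F (x', y) in uniformity. x' = x \<longrightarrow> y \<in> U)" for U :: "'a with_unit set"
    by (rule open_with_unit_def)
  show "norm x = 0 \<longleftrightarrow> x = 0"
  proof
    assume "norm x = 0"
    then have "scalar_part x = 0" "action_norm x = 0"
      unfolding norm_with_unit_def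
      by (smt (verit) action_norm_nonneg norm_ge_zero norm_eq_zero max.cobounded1 max.cobounded2)+
    then show "x = 0" using action_norm_eq_0D by (cases x) (auto simp: zero_with_unit_def)
  next
    assume "x = 0"
    moreover have "action_norm (0::'a with_unit) \<le> 0"
      by (rule action_norm_le) (simp_all add: left_action_def zero_with_unit_def)
    ultimately show "norm x = 0"
      by (simp add: norm_with_unit_def) (simp add: zero_with_unit_def)
  qed
  have "action_norm (x + y) \<le> action_norm x + action_norm y"
  proof (rule action_norm_le)
    show "norm (left_action (x + y) u) \<le> (action_norm x + action_norm y) * norm u" for u
      unfolding left_action_add distrib_right by (intro norm_triangle_mono action_norm_bound)
  qed simp
  moreover have "cmod (scalar_part (x + y)) \<le> cmod (scalar_part x) + cmod (scalar_part y)"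
    by (simp add: plus_with_unit_def norm_triangle_ineq)
  ultimately show "norm (x + y) \<le> norm x + norm y" unfolding norm_with_unit_def by linarith
  have scale_le: "action_norm (t *\<^sub>R v) \<le> \<bar>t\<bar> * action_norm v" for t :: real and v :: "'a with_unit"
  proof (rule action_norm_le)
    show "norm (left_action (t *\<^sub>R v) u) \<le> \<bar>t\<bar> * action_norm v * norm u" for u
      by (simp add: left_action_scaleR mult.assoc mult_left_mono action_norm_bound)
  qed simp
  have "action_norm (r *\<^sub>R x) = \<bar>r\<bar> * action_norm x"
  proof (cases "r = 0")
    case False
    have "inverse r *\<^sub>R (r *\<^sub>R x) = x" using False by (simp add: scaleR_with_unit_def)
    then have "action_norm x \<le> \<bar>inverse r\<bar> * action_norm (r *\<^sub>R x)"
      using scale_le[of "inverse r" "r *\<^sub>R x"] by simp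
    then have "\<bar>r\<bar> * action_norm x \<le> action_norm (r *\<^sub>R x)" using False by (simp add: field_simps)
    then show ?thesis using scale_le[of r x] by simp
  qed (use scale_le[of 0 x] in \<open>simp add: order_antisym\<close>)
  then show "norm (r *\<^sub>R x) = \<bar>r\<bar> * norm x"
    by (simp add: norm_with_unit_def max_mult_distrib_left) (simp add: scaleR_with_unit_def)
  have "action_norm (x * y) \<le> action_norm x * action_norm y" by (rule action_norm_mult)
  also have "\<dots> \<le> norm x * norm y"
    unfolding norm_with_unit_def by (intro mult_mono) (auto simp: le_max_iff_disj)
  finally have "action_norm (x * y) \<le> norm x * norm y" .
  moreover have "cmod (scalar_part (x * y)) \<le> norm x * norm y"
    unfolding norm_with_unit_def
    by (simp add: times_with_unit_def norm_mult) (intro mult_mono, auto simp: le_max_iff_disj)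
  ultimately show "norm (x * y) \<le> norm x * norm y" by (simp add: norm_with_unit_def)
  have "action_norm (1::'a with_unit) \<le> 1"
    by (rule action_norm_le) (simp_all add: left_action_def one_with_unit_def)
  then show "norm (1::'a with_unit) = 1"
    by (simp add: norm_with_unit_def) (simp add: one_with_unit_def max_def)
qed (simp_all add: with_unit_eq_iff with_unit_ops scaleR_add_right scaleR_add_left)

end

lemma element_part_simps [simp]:
  "element_part (x + y) = element_part x + element_part y" "element_part (x - y) = element_part x - element_part y"
  "element_part (- x) = - element_part x" "element_part 0 = 0" "element_part 1 = 0"
  "element_part (r *\<^sub>R x) = r *\<^sub>R element_part x"
  "element_part (x * y) = element_part x * element_part y + scalar_part x *\<^sub>C element_part y
      + scalar_part y *\<^sub>C element_part x"
  by (simp_all add: with_unit_ops)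

lemma scalar_part_simps [simp]:
  "scalar_part (x + y) = scalar_part x + scalar_part y" "scalar_part (x - y) = scalar_part x - scalar_part y"
  "scalar_part (- x) = - scalar_part x" "scalar_part 0 = 0" "scalar_part 1 = 1"
  "scalar_part (r *\<^sub>R x) = r *\<^sub>R scalar_part x"
  "scalar_part (x * y) = scalar_part x * scalar_part y"
  by (simp_all add: with_unit_ops)

lemma action_norm_Adjoin_0: "action_norm (Adjoin a 0) = norm a"
proof (rule antisym)
  show "action_norm (Adjoin a 0) \<le> norm a"
    by (rule action_norm_le) (simp_all add: left_action_def norm_mult_ineq)
  have "norm a * norm a \<le> action_norm (Adjoin a 0) * norm a"
    using action_norm_bound[of "Adjoin a 0" "star a"] cstar_identity[of "star a"]
    by (simp add: left_action_def star_star power2_eq_square)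
  then show "norm a \<le> action_norm (Adjoin a 0)" by (cases "a = 0") simp_all
qed

lemma norm_Adjoin_0 [simp]: "norm (Adjoin a 0) = norm a"
  by (simp add: norm_with_unit_def action_norm_Adjoin_0)

lemma norm_Adjoin_scalar_le: "norm (Adjoin (0::'a::cstar_algebra) s) \<le> cmod s"
proof -
  have "action_norm (Adjoin (0::'a) s) \<le> cmod s"
    by (rule action_norm_le) (simp_all add: left_action_def norm_scaleC)
  then show ?thesis by (simp add: norm_with_unit_def)
qed

lemma norm_with_unit_le: "norm x \<le> norm (element_part x) + cmod (scalar_part x)"
proof -
  have "x = Adjoin (element_part x) 0 + Adjoin 0 (scalar_part x)" by (simp add: with_unit_eq_iff)
  then have "norm x \<le> norm (Adjoin (element_part x) 0) + norm (Adjoin (0::'a) (scalar_part x))"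
    by (metis norm_triangle_ineq)
  then show ?thesis using norm_Adjoin_scalar_le[of "scalar_part x", where ?'a = 'a] by simp
qed

lemma bounded_linear_scalar_part: "bounded_linear (scalar_part :: 'a::cstar_algebra with_unit \<Rightarrow> complex)"
  by (rule bounded_linear_intro[where K = 1]) (simp_all add: norm_with_unit_def)

lemma bounded_linear_element_part: "bounded_linear (element_part :: 'a::cstar_algebra with_unit \<Rightarrow> 'a)"
proof (rule bounded_linear_intro[where K = 2])
  fix x :: "'a with_unit"
  have "Adjoin (element_part x) 0 = x - Adjoin 0 (scalar_part x)" by (simp add: with_unit_eq_iff)
  then have "norm (element_part x) \<le> norm x + norm (Adjoin (0::'a) (scalar_part x))"
    by (metis norm_Adjoin_0 norm_triangle_ineq4)
  also have "norm (Adjoin (0::'a) (scalar_part x)) \<le> norm x"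
    using norm_Adjoin_scalar_le[of "scalar_part x", where ?'a = 'a] by (simp add: norm_with_unit_def)
  finally show "norm (element_part x) \<le> norm x * 2" by simp
qed simp_all

instance with_unit :: (cstar_algebra) banach
proof
  fix X :: "nat \<Rightarrow> 'a with_unit" assume X: "Cauchy X"
  have "Cauchy (\<lambda>n. element_part (X n))" "Cauchy (\<lambda>n. scalar_part (X n))"
    by (rule bounded_linear.Cauchy[OF bounded_linear_element_part X]
        bounded_linear.Cauchy[OF bounded_linear_scalar_part X])+
  then obtain a s where lim: "(\<lambda>n. element_part (X n)) \<longlonglongrightarrow> a" "(\<lambda>n. scalar_part (X n)) \<longlonglongrightarrow> s"
    by (meson Cauchy_convergent convergent_def)
  have "(\<lambda>n. X n - Adjoin a s) \<longlonglongrightarrow> 0"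
  proof (rule Lim_null_comparison)
    show "\<forall>\<^sub>F n in sequentially. norm (X n - Adjoin a s)
        \<le> norm (element_part (X n) - a) + cmod (scalar_part (X n) - s)"
      using norm_with_unit_le[of "X n - Adjoin a s" for n] by simp
    have "(\<lambda>n. norm (element_part (X n) - a) + cmod (scalar_part (X n) - s)) \<longlonglongrightarrow> 0 + 0"
      using lim by (intro tendsto_add tendsto_norm_zero) (simp_all add: LIM_zero)
    then show "(\<lambda>n. norm (element_part (X n) - a) + cmod (scalar_part (X n) - s)) \<longlonglongrightarrow> 0" by simp
  qed
  then show "convergent X" unfolding convergent_def using LIM_zero_cancel by blast
qed

instantiation with_unit :: (cstar_algebra) unital_cstar_algebra
begin

definition scaleC_with_unit :: "complex \<Rightarrow> 'a with_unit \<Rightarrow> 'a with_unit" where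
  "c *\<^sub>C x = Adjoin (c *\<^sub>C element_part x) (c * scalar_part x)"
definition star_with_unit :: "'a with_unit \<Rightarrow> 'a with_unit" where
  "star x = Adjoin (star (element_part x)) (cnj (scalar_part x))"

lemma scaleC_star_parts [simp]:
  "element_part (c *\<^sub>C x) = c *\<^sub>C element_part x" "scalar_part (c *\<^sub>C x) = c * scalar_part x"
  "element_part (star x) = star (element_part x)" "scalar_part (star x) = cnj (scalar_part x)"
  by (simp_all add: scaleC_with_unit_def star_with_unit_def)

lemma left_action_adjoint: "star (left_action x y) * z = star y * left_action (star x) z"
  by (simp add: left_action_def star_simps distrib_left distrib_right mult_scaleC_left
      mult_scaleC_right mult.assoc)

text \<open>
  By the \<open>C\<^sup>*\<close>-identity of \<open>A\<close>, \<open>\<parallel>x y\<parallel>\<^sup>2 = \<parallel>y\<^sup>* (x\<^sup>* x) y\<parallel>\<close> for \<open>y\<close> in \<open>A\<close>.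
\<close>

lemma action_norm_square_le: "(action_norm x)\<^sup>2 \<le> action_norm (star x * x)"
proof -
  have "action_norm x \<le> sqrt (action_norm (star x * x))"
  proof (rule action_norm_le)
    fix y
    have "(norm (left_action x y))\<^sup>2 = norm (star y * left_action (star x * x) y)"
      by (simp add: left_action_mult flip: cstar_identity left_action_adjoint)
    also have "\<dots> \<le> norm y * (action_norm (star x * x) * norm y)"
      using norm_mult_ineq[of "star y" "left_action (star x * x) y"]
        mult_left_mono[OF action_norm_bound[of "star x * x" y] norm_ge_zero[of y]] by simp
    also have "\<dots> = (sqrt (action_norm (star x * x)) * norm y)\<^sup>2"
      by (simp add: power_mult_distrib power2_eq_square)
    finally show "norm (left_action x y) \<le> sqrt (action_norm (star x * x)) * norm y"
      by (rule power2_le_imp_le) simp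
  qed simp
  then have "(action_norm x)\<^sup>2 \<le> (sqrt (action_norm (star x * x)))\<^sup>2" by (intro power_mono) auto
  then show ?thesis by simp
qed

lemma action_norm_cstar: "action_norm (star x * x) = (action_norm x)\<^sup>2"
proof -
  have le: "action_norm y \<le> action_norm (star y)" for y :: "'a with_unit"
  proof (cases "action_norm y = 0")
    case False
    have "action_norm y * action_norm y \<le> action_norm (star y) * action_norm y"
      using action_norm_square_le[of y] action_norm_mult[of "star y" y] by (simp add: power2_eq_square)
    then show ?thesis using False action_norm_nonneg[of y] by (simp add: mult_le_cancel_right)
  qed simp
  have "star (star x) = x" by (simp add: with_unit_eq_iff star_star)
  then have "action_norm (star x) = action_norm x" using le[of x] le[of "star x"] by simp
  then show ?thesis
    using action_norm_square_le[of x] action_norm_mult[of "star x" x] by (simp add: power2_eq_square)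
qed

instance
proof
  fix x y :: "'a with_unit" and c d :: complex and t :: real
  have scale_le: "action_norm (c *\<^sub>C v) \<le> cmod c * action_norm v" for c and v :: "'a with_unit"
  proof (rule action_norm_le)
    have "left_action (c *\<^sub>C v) u = c *\<^sub>C left_action v u" for u
      by (simp add: left_action_def mult_scaleC_left scaleC_add_right scaleC_scaleC)
    then show "norm (left_action (c *\<^sub>C v) u) \<le> cmod c * action_norm v * norm u" for u
      by (simp add: norm_scaleC mult.assoc mult_left_mono action_norm_bound)
  qed simp
  have "action_norm (c *\<^sub>C x) = cmod c * action_norm x"
  proof (cases "c = 0")
    case False
    have "inverse c *\<^sub>C (c *\<^sub>C x) = x" using False by (simp add: with_unit_eq_iff scaleC_scaleC)
    then have "action_norm x \<le> cmod (inverse c) * action_norm (c *\<^sub>C x)"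
      using scale_le[of "inverse c" "c *\<^sub>C x"] by simp
    then have "cmod c * action_norm x \<le> action_norm (c *\<^sub>C x)"
      using False by (simp add: norm_inverse norm_divide field_simps)
    then show ?thesis using scale_le[of c x] by simp
  qed (use scale_le[of 0 x] in \<open>simp add: order_antisym\<close>)
  then show "norm (c *\<^sub>C x) = cmod c * norm x"
    by (simp add: norm_with_unit_def max_mult_distrib_left norm_mult)
  have "(max u v)\<^sup>2 = max (u\<^sup>2) (v\<^sup>2)" if "u \<ge> 0" "v \<ge> 0" for u v :: real
    using that by (simp add: max_def power_mono_iff)
  then show "norm (star x * x) = (norm x)\<^sup>2"
    by (simp add: norm_with_unit_def action_norm_cstar norm_mult power2_eq_square[of "cmod (scalar_part x)", symmetric])
qed (simp_all add: with_unit_eq_iff scaleC_add_right scaleC_add_left scaleC_scaleC scaleC_of_real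
    mult_scaleC_left mult_scaleC_right star_simps distrib_left distrib_right
    scaleR_conv_of_real[where 'a = complex] ac_simps)

end

section \<open>Invertibility, spectrum and conjugation in the unitization\<close>

text \<open>
  Says that \<open>1 + f\<close> is inverse to \<open>1 + e\<close>, without reference to the unit.
\<close>

definition quasi_inverse :: "'a::cstar_algebra \<Rightarrow> 'a \<Rightarrow> bool" where
  "quasi_inverse e f \<longleftrightarrow> e + f + e * f = 0 \<and> e + f + f * e = 0"

lemma identity_element_unique: "identity_element u \<Longrightarrow> identity_element v \<Longrightarrow> u = v"
  unfolding identity_element_def by metis

lemma unitization_unital:
  fixes u :: "'a::cstar_algebra"
  assumes "identity_element u"
  shows "unital TYPE('a)" "(THE u::'a. identity_element u) = u"
  using assms identity_element_unique by (auto simp: unital_def)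

lemma monoid_unitization: "monoid (unitization :: ('a::cstar_algebra \<times> complex) monoid)"
proof (cases "unital TYPE('a)")
  case True
  then obtain u :: 'a where u: "identity_element u" unfolding unital_def by blast
  note U = unitization_unital[OF u]
  show ?thesis using u
    by (intro monoidI) (auto simp: unitization_def U identity_element_def mult.assoc)
next
  case False
  then show ?thesis
    by (intro monoidI) (auto simp: unitization_def algebra_simps scaleC_add_right scaleC_add_left
        scaleC_scaleC mult_scaleC_left mult_scaleC_right)
qed

lemma one_plus_mult: "one_plus e \<otimes>\<^bsub>unitization\<^esub> one_plus f = one_plus (e + f + e * f)"
  and one_plus_embed: "one_plus e \<otimes>\<^bsub>unitization\<^esub> embed x = embed (x + e * x)"
  and embed_one_plus: "embed x \<otimes>\<^bsub>unitization\<^esub> one_plus e = embed (x + x * e)"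
  for e :: "'a::cstar_algebra"
proof -
  have "one_plus e \<otimes>\<^bsub>unitization\<^esub> one_plus f = one_plus (e + f + e * f) \<and>
    one_plus e \<otimes>\<^bsub>unitization\<^esub> embed x = embed (x + e * x) \<and>
    embed x \<otimes>\<^bsub>unitization\<^esub> one_plus e = embed (x + x * e)"
  proof (cases "unital TYPE('a)")
    case True
    then obtain u :: 'a where u: "identity_element u" unfolding unital_def by blast
    note U = unitization_unital[OF u]
    show ?thesis using u
      by (auto simp: unitization_def U identity_element_def one_plus_def embed_def distrib_left
          distrib_right add_ac)
  next
    case False
    then show ?thesis by (auto simp: unitization_def one_plus_def embed_def add_ac)
  qed
  then show "one_plus e \<otimes>\<^bsub>unitization\<^esub> one_plus f = one_plus (e + f + e * f)"
    "one_plus e \<otimes>\<^bsub>unitization\<^esub> embed x = embed (x + e * x)"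
    "embed x \<otimes>\<^bsub>unitization\<^esub> one_plus e = embed (x + x * e)" by auto
qed

lemma one_plus_zero: "one_plus 0 = \<one>\<^bsub>unitization\<^esub>"
  by (simp add: one_plus_def embed_def flip: zero_prod_def)

lemma one_plus_inject: "one_plus e = one_plus f \<longleftrightarrow> e = f"
  by (simp add: one_plus_def embed_def)

lemma one_plus_carrier: "one_plus e \<in> carrier unitization"
  by (auto simp: one_plus_def embed_def unitization_def)

lemma one_plus_mult_eq_one:
  "one_plus e \<otimes>\<^bsub>unitization\<^esub> one_plus f = \<one>\<^bsub>unitization\<^esub> \<longleftrightarrow> e + f + e * f = 0"
  by (simp add: one_plus_mult one_plus_inject flip: one_plus_zero)

text \<open>
  In the unital case every element has the form \<open>1 + f\<close>; otherwise the scalar part of an inverse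
  of \<open>1 + e\<close> must be \<open>1\<close>.
\<close>

lemma inverse_is_one_plus:
  fixes e :: "'a::cstar_algebra"
  assumes "y \<in> carrier unitization" "y \<otimes>\<^bsub>unitization\<^esub> one_plus e = \<one>\<^bsub>unitization\<^esub>"
  obtains f where "y = one_plus f"
proof (cases "unital TYPE('a)")
  case True
  then show ?thesis using assms(1) that[of "fst y - fst (one_plus (0::'a))"]
    by (auto simp: one_plus_def unitization_def embed_def)
next
  case False
  then show ?thesis using assms that[of "fst y"]
    by (cases y) (auto simp: one_plus_def unitization_def embed_def)
qed

lemma one_plus_Units: "one_plus e \<in> Units unitization \<longleftrightarrow> (\<exists>f. quasi_inverse e f)"
proof
  assume "one_plus e \<in> Units unitization"
  then obtain y where y: "y \<in> carrier unitization" "y \<otimes>\<^bsub>unitization\<^esub> one_plus e = \<one>\<^bsub>unitization\<^esub>"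
    "one_plus e \<otimes>\<^bsub>unitization\<^esub> y = \<one>\<^bsub>unitization\<^esub>"
    by (auto simp: Units_def)
  obtain f where "y = one_plus f" using inverse_is_one_plus[OF y(1,2)] .
  then have "quasi_inverse e f"
    using y by (simp add: one_plus_mult_eq_one quasi_inverse_def add.commute)
  then show "\<exists>f. quasi_inverse e f" ..
next
  assume "\<exists>f. quasi_inverse e f"
  then obtain f where "quasi_inverse e f" ..
  then show "one_plus e \<in> Units unitization"
    unfolding Units_def
    by (auto simp: one_plus_mult_eq_one quasi_inverse_def one_plus_carrier add.commute
        intro!: bexI[of _ "one_plus f"])
qed

lemma conjugate_by_eq:
  assumes "quasi_inverse e f"
  shows "conjugate_by e x = embed (x + e * x + (x + e * x) * f)"
proof -
  interpret monoid "unitization :: ('a \<times> complex) monoid" by (rule monoid_unitization)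
  have "inv\<^bsub>unitization\<^esub> (one_plus e) = one_plus f"
    by (rule inv_unique'[symmetric])
      (use assms in \<open>simp_all add: one_plus_mult_eq_one quasi_inverse_def one_plus_carrier add.commute\<close>)
  then show ?thesis by (simp add: conjugate_by_def one_plus_embed embed_one_plus)
qed

lemma unitization_norm_embed: "unitization_norm (embed x) = norm (x::'a::cstar_algebra)"
proof (cases "unital TYPE('a)")
  case False
  have le: "norm (x * y) \<le> norm x" if "y \<in> cball 0 1" for y
    using that norm_mult_ineq[of x y] by (simp add: mult_left_le order_trans)
  have "(SUP y\<in>cball 0 1. norm (x * y)) = norm x"
  proof (rule antisym)
    show "(SUP y\<in>cball 0 1. norm (x * y)) \<le> norm x"
      by (rule cSUP_least) (use le in auto)
    let ?y = "(1 / norm x) *\<^sub>R star x"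
    have "norm (x * ?y) \<le> (SUP y\<in>cball 0 1. norm (x * y))"
      by (rule cSUP_upper) (use le in \<open>auto intro!: bdd_aboveI2\<close>)
    moreover have "norm (x * ?y) = norm x"
      using cstar_identity[of "star x"] by (simp add: star_star power2_eq_square)
    ultimately show "norm x \<le> (SUP y\<in>cball 0 1. norm (x * y))" by simp
  qed
  then show ?thesis using False by (simp add: unitization_norm_def embed_def)
qed (simp add: unitization_norm_def embed_def)

lemma unitization_scaleC_Units:
  fixes X :: "'a::cstar_algebra \<times> complex"
  assumes "c \<noteq> 0"
  shows "unitization_scaleC c X \<in> Units unitization \<longleftrightarrow> X \<in> Units unitization"
proof -
  have mult: "unitization_scaleC c X \<otimes>\<^bsub>unitization\<^esub> unitization_scaleC d Y
      = unitization_scaleC (c * d) (X \<otimes>\<^bsub>unitization\<^esub> Y)" for c d and X Y :: "'a \<times> complex"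
    by (cases X; cases Y) (simp add: unitization_def unitization_scaleC_def scaleC_add_right
        scaleC_scaleC mult_scaleC_left mult_scaleC_right ac_simps)
  have one: "unitization_scaleC 1 X = X" for X :: "'a \<times> complex"
    by (cases X) (simp add: unitization_scaleC_def)
  have cancel: "unitization_scaleC d (unitization_scaleC c X) = X" if "d * c = 1" for c d and X :: "'a \<times> complex"
    using that by (cases X) (simp add: unitization_scaleC_def scaleC_scaleC flip: mult.assoc)
  have carrier: "unitization_scaleC c X \<in> carrier unitization" if "X \<in> carrier unitization" for c and X :: "'a \<times> complex"
    using that by (cases X) (auto simp: unitization_scaleC_def unitization_def split: if_splits)
  have imp: "unitization_scaleC c X \<in> Units unitization"
    if c: "c \<noteq> 0" and X: "X \<in> Units unitization" for c and X :: "'a \<times> complex"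
  proof -
    obtain Y where "Y \<in> carrier unitization" "Y \<otimes>\<^bsub>unitization\<^esub> X = \<one>\<^bsub>unitization\<^esub>"
      "X \<otimes>\<^bsub>unitization\<^esub> Y = \<one>\<^bsub>unitization\<^esub>" "X \<in> carrier unitization"
      using X by (auto simp: Units_def)
    then show ?thesis using c unfolding Units_def
      by (auto simp: mult one carrier intro!: bexI[of _ "unitization_scaleC (inverse c) Y"])
  qed
  show ?thesis
    using imp[OF assms, of X] imp[of "inverse c" "unitization_scaleC c X"] assms
    by (auto simp: cancel)
qed

text \<open>
  \<open>x - c 1\<close> is the multiple \<open>- c (1 - x / c)\<close>.
\<close>

lemma spectrum_iff:
  assumes "c \<noteq> 0"
  shows "c \<in> spectrum x \<longleftrightarrow> (\<nexists>f. quasi_inverse (- ((1 / c) *\<^sub>C x)) f)"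
proof -
  have "embed x - unitization_scaleC c \<one>\<^bsub>unitization\<^esub>
      = unitization_scaleC (- c) (one_plus (- ((1 / c) *\<^sub>C x)))"
    using assms
    by (cases "\<one>\<^bsub>unitization\<^esub> :: 'a \<times> complex")
      (simp add: one_plus_def embed_def unitization_scaleC_def scaleC_diff_right scaleC_scaleC)
  then show ?thesis
    using assms by (simp add: spectrum_def one_plus_Units unitization_scaleC_Units)
qed

lemma quasi_inverse_iff_with_unit:
  "quasi_inverse e f \<longleftrightarrow> (1 + Adjoin e 0) * (1 + Adjoin f 0) = 1 \<and> (1 + Adjoin f 0) * (1 + Adjoin e 0) = 1"
  by (simp add: quasi_inverse_def with_unit_eq_iff add_ac)

lemma with_unit_inverse_one_plus:
  assumes "y * (1 + Adjoin e 0) = 1"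
  shows "y = 1 + Adjoin (element_part y) 0"
  using arg_cong[OF assms, of scalar_part] by (simp add: with_unit_eq_iff)

lemma spectrum_iff_with_unit:
  fixes x :: "'a::cstar_algebra"
  assumes "c \<noteq> 0"
  shows "c \<in> spectrum x \<longleftrightarrow>
    (\<nexists>y. y * (1 - (1 / c) *\<^sub>C Adjoin x 0) = 1 \<and> (1 - (1 / c) *\<^sub>C Adjoin x 0) * y = 1)"
proof -
  have eq: "1 - (1 / c) *\<^sub>C Adjoin x 0 = 1 + Adjoin (- ((1 / c) *\<^sub>C x)) 0"
    by (simp add: with_unit_eq_iff)
  show ?thesis
    unfolding spectrum_iff[OF assms] eq quasi_inverse_iff_with_unit
    by (metis with_unit_inverse_one_plus)
qed

lemma spectrum_norm_le:
  assumes "c \<in> spectrum x"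
  shows "cmod c \<le> norm x"
proof (rule ccontr)
  assume "\<not> cmod c \<le> norm x"
  then have c: "norm x < cmod c" "c \<noteq> 0" using norm_ge_zero[of x] by (auto simp del: norm_ge_zero)
  then have "norm ((1 / c) *\<^sub>C Adjoin x 0) < 1"
    by (simp add: norm_scaleC norm_divide)
  then obtain y where "y * (1 - (1 / c) *\<^sub>C Adjoin x 0) = 1" "(1 - (1 / c) *\<^sub>C Adjoin x 0) * y = 1"
    using neumann_inverse by blast
  then show False using assms spectrum_iff_with_unit[OF c(2)] by blast
qed

lemma spectral_radius_upper: "c \<in> spectrum x \<Longrightarrow> cmod c \<le> spectral_radius x"
  unfolding spectral_radius_def
  by (intro cSup_upper bdd_aboveI[of _ "norm x"]) (auto simp: spectrum_norm_le)

lemma spectral_radius_nonneg: "0 \<le> spectral_radius x"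
  unfolding spectral_radius_def
  by (intro cSup_upper bdd_aboveI[of _ "norm x"]) (auto simp: spectrum_norm_le)

lemma spectral_radius_le:
  assumes "0 \<le> t" "\<And>c. c \<in> spectrum x \<Longrightarrow> c \<noteq> 0 \<Longrightarrow> cmod c \<le> t"
  shows "spectral_radius x \<le> t"
  unfolding spectral_radius_def
proof (rule cSup_least)
  show "r \<le> t" if "r \<in> insert 0 (cmod ` spectrum x)" for r
    using that assms by (auto; metis norm_zero)
qed simp

lemma conjugate_with_unit:
  "Adjoin (x + e * x + (x + e * x) * f) 0 = (1 + Adjoin e 0) * Adjoin x 0 * (1 + Adjoin f 0)"
  by (simp add: with_unit_eq_iff add_ac)

lemma spectral_radius_le_conjugate:
  assumes ef: "quasi_inverse e f"
  shows "spectral_radius x \<le> norm (x + e * x + (x + e * x) * f)"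
proof (rule spectral_radius_le)
  let ?y = "x + e * x + (x + e * x) * f"
  let ?X = "Adjoin x 0" and ?Y = "Adjoin ?y 0" and ?H = "1 + Adjoin e 0" and ?K = "1 + Adjoin f 0"
  have HK: "?H * ?K = 1" "?K * ?H = 1" using ef by (simp_all add: quasi_inverse_iff_with_unit)
  fix c assume c: "c \<in> spectrum x" "c \<noteq> 0"
  have "c \<in> spectrum ?y"
  proof (rule ccontr)
    assume "c \<notin> spectrum ?y"
    then obtain z where z: "z * (1 - (1 / c) *\<^sub>C ?Y) = 1" "(1 - (1 / c) *\<^sub>C ?Y) * z = 1"
      using spectrum_iff_with_unit[OF c(2)] by blast
    have "?K * ((1 / c) *\<^sub>C ?Y) * ?H = (1 / c) *\<^sub>C ((?K * ?H) * ?X * (?K * ?H))"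
      by (simp only: conjugate_with_unit mult_scaleC_left mult_scaleC_right mult.assoc)
    then have X: "1 - (1 / c) *\<^sub>C ?X = ?K * (1 - (1 / c) *\<^sub>C ?Y) * ?H"
      by (simp only: right_diff_distrib left_diff_distrib HK mult_1 mult_1_right)
    have "(?K * z * ?H) * (1 - (1 / c) *\<^sub>C ?X) = ?K * z * (?H * ?K) * (1 - (1 / c) *\<^sub>C ?Y) * ?H"
      unfolding X by (simp only: mult.assoc)
    also have "\<dots> = ?K * (z * (1 - (1 / c) *\<^sub>C ?Y)) * ?H" by (simp only: HK mult_1_right mult.assoc)
    finally have 1: "(?K * z * ?H) * (1 - (1 / c) *\<^sub>C ?X) = 1" by (simp only: z HK mult_1_right)
    have "(1 - (1 / c) *\<^sub>C ?X) * (?K * z * ?H) = ?K * (1 - (1 / c) *\<^sub>C ?Y) * (?H * ?K) * z * ?H"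
      unfolding X by (simp only: mult.assoc)
    also have "\<dots> = ?K * ((1 - (1 / c) *\<^sub>C ?Y) * z) * ?H" by (simp only: HK mult_1_right mult.assoc)
    finally have 2: "(1 - (1 / c) *\<^sub>C ?X) * (?K * z * ?H) = 1" by (simp only: z HK mult_1_right)
    show False using 1 2 c spectrum_iff_with_unit[OF c(2)] by blast
  qed
  then show "cmod c \<le> norm ?y" by (rule spectrum_norm_le)
qed simp

lemma summable_of_spectral_radius_less:
  fixes x :: "'a::cstar_algebra"
  assumes "spectral_radius x < t"
  shows "summable (\<lambda>n. (norm (((1 / t) *\<^sub>R Adjoin x 0) ^ n))\<^sup>2)"
proof -
  \<comment> \<open>a radius strictly between leaves room for the disc of radius \<open>t / \<rho> > 1\<close>\<close>
  define \<rho> where "\<rho> = (spectral_radius x + t) / 2"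
  have \<rho>: "spectral_radius x < \<rho>" "\<rho> < t" "\<rho> > 0"
    using assms spectral_radius_nonneg[of x] by (auto simp: \<rho>_def)
  show ?thesis
  proof (rule summable_norm_power_square)
    show "t / \<rho> > 1" using \<rho> by simp
    fix z :: complex assume z: "cmod z \<le> t / \<rho>"
    show "\<exists>y. y * (1 - z *\<^sub>C ((1 / t) *\<^sub>R Adjoin x 0)) = 1 \<and> (1 - z *\<^sub>C ((1 / t) *\<^sub>R Adjoin x 0)) * y = 1"
    proof (cases "z = 0")
      case True
      then show ?thesis by (intro exI[of _ 1]) simp
    next
      case False
      define c where "c = of_real t / z"
      have c: "c \<noteq> 0" using \<rho> False by (simp add: c_def)
      have "cmod c = t / cmod z" using \<rho> by (simp add: c_def norm_divide)
      also have "\<dots> \<ge> \<rho>" using z False \<rho> by (simp add: field_simps)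
      finally have "c \<notin> spectrum x" using spectral_radius_upper[of c x] \<rho> by auto
      moreover have "(1 / c) *\<^sub>C Adjoin x 0 = z *\<^sub>C ((1 / t) *\<^sub>R Adjoin x 0)"
        by (simp add: c_def scaleC_scaleC flip: scaleC_of_real)
      ultimately show ?thesis using spectrum_iff_with_unit[OF c, of x] by auto
    qed
  qed
qed

lemma closed_two_sided_ideal_with_unit:
  fixes I :: "'a::cstar_algebra set"
  assumes "closed_two_sided_ideal I"
  shows "closed_two_sided_ideal ((\<lambda>x. Adjoin x 0) ` I)"
proof -
  have eq: "(\<lambda>x. Adjoin x 0) ` I = scalar_part -` {0} \<inter> element_part -` I"
    by (auto simp: image_iff with_unit_eq_iff)
  have "closed (scalar_part -` {0} \<inter> element_part -` I)"
    using ideal_closed[OF assms]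
    by (intro closed_Int continuous_closed_vimage linear_continuous_at bounded_linear_scalar_part
        bounded_linear_element_part) auto
  then show ?thesis
    unfolding closed_two_sided_ideal_def eq
    using assms by (auto simp: ideal_zero ideal_add ideal_scaleC ideal_mult_left ideal_mult_right)
qed

lemma quotient_norm_le:
  assumes "closed_two_sided_ideal I" "x \<in> I"
  shows "quotient_norm (ideal_coset I a) \<le> norm (a + x)"
  unfolding quotient_norm_def ideal_coset_def
  by (rule cINF_lower) (use assms in \<open>auto intro!: bdd_belowI2[of _ 0]\<close>)

lemma quotient_norm_less:
  assumes "closed_two_sided_ideal I" "quotient_norm (ideal_coset I a) < t"
  obtains x where "x \<in> I" "norm (a + x) < t"
proof -
  have "ideal_coset I a \<noteq> {}" using ideal_zero[OF assms(1)] by (auto simp: ideal_coset_def)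
  moreover have "bdd_below (norm ` ideal_coset I a)" by (auto intro!: bdd_belowI2[of _ 0])
  ultimately have "\<exists>z\<in>ideal_coset I a. norm z < t"
    using assms(2) by (simp add: quotient_norm_def cINF_less_iff)
  then show ?thesis using that by (auto simp: ideal_coset_def)
qed

text \<open>
  The square root \<open>g\<close> of \<open>1 + p\<close> lies in every closed subalgebra that contains \<open>1 + p\<close>, in particular in \<open>I \<oplus> \<complex>\<close>. Its
  scalar part squares to \<open>1\<close>, so \<open>g\<close> or \<open>- g\<close> belongs to \<open>1 + I\<close>.
\<close>

lemma sqrt_one_plus_ideal:
  fixes I :: "'a::cstar_algebra set"
  assumes I: "closed_two_sided_ideal I" and p: "p \<in> I" "positive_element (Adjoin p 0)"
  obtains e f where "e \<in> I" "quasi_inverse e f" "star (1 + Adjoin e 0) = 1 + Adjoin e 0"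
    "(1 + Adjoin e 0) * (1 + Adjoin e 0) = 1 + Adjoin p 0"
proof -
  let ?s = "1 + Adjoin p 0"
  have "positive_element ?s" using p by (simp add: positive_add)
  then obtain g where g: "positive_element g" "g * g = ?s"
    "\<And>S. closed_subalgebra S \<Longrightarrow> ?s \<in> S \<Longrightarrow> g \<in> S" using positive_sqrt by blast
  have "closed (element_part -` I)"
    using ideal_closed[OF I]
    by (intro continuous_closed_vimage linear_continuous_at bounded_linear_element_part) auto
  then have "closed_subalgebra (element_part -` I)"
    using I by (auto simp: closed_subalgebra_def ideal_zero ideal_add ideal_scaleC ideal_scaleR
        ideal_mult_left)
  then have "g \<in> element_part -` I" by (rule g(3)) (simp add: p)
  then have gI: "element_part g \<in> I" by simp
  have "scalar_part g * scalar_part g = 1"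
    using arg_cong[OF g(2), of scalar_part] by simp
  then have sg: "scalar_part g = 1 \<or> scalar_part g = - 1" by (rule square_eq_1_iff[THEN iffD1])
  define e where "e = scalar_part g *\<^sub>C element_part g"
  have he: "1 + Adjoin e 0 = (if scalar_part g = 1 then g else - g)"
    using sg by (auto simp: e_def with_unit_eq_iff)
  have sq: "(1 + Adjoin e 0) * (1 + Adjoin e 0) = ?s" using g(2) by (simp add: he)
  have st: "star (1 + Adjoin e 0) = 1 + Adjoin e 0" using positive_star[OF g(1)] by (simp add: he)
  obtain r where r: "r * ?s = 1" "?s * r = 1" using positive_one_plus_inverse[OF p(2)] by metis
  let ?h = "1 + Adjoin e 0"
  have 1: "?h * (?h * r) = 1" by (simp only: mult.assoc[symmetric] sq r)
  have 2: "(r * ?h) * ?h = 1" by (simp only: mult.assoc sq r)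
  have "r * ?h = (r * ?h) * (?h * (?h * r))" by (simp only: 1 mult_1_right)
  also have "\<dots> = ((r * ?h) * ?h) * (?h * r)" by (simp only: mult.assoc)
  also have "\<dots> = ?h * r" by (simp only: 2 mult_1)
  finally have inv: "(?h * r) * ?h = 1" using 2 by (simp only:)
  then have "?h * r = 1 + Adjoin (element_part (?h * r)) 0" by (rule with_unit_inverse_one_plus)
  then have "quasi_inverse e (element_part (?h * r))"
    using 1 inv unfolding quasi_inverse_iff_with_unit by metis
  moreover have "e \<in> I" using gI by (simp add: e_def ideal_scaleC[OF I])
  ultimately show ?thesis using st sq that by blast
qed

text \<open>
  The two hypotheses on \<open>b\<^sub>i = a\<^sub>i / c\<^sub>i\<close> play separate roles: the strict bound on the spectral radius
  makes the Stein sums converge, and the bound on the quotient norm gives the positive elements of the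
  ideal to which they are applied.
\<close>

theorem simultaneous_conjugation:
  fixes I :: "'a::cstar_algebra set" and a :: "'i \<Rightarrow> 'a" and c :: "'i \<Rightarrow> real"
  assumes I: "closed_two_sided_ideal I" and "finite F"
    and comm: "\<And>i j. i \<in> F \<Longrightarrow> j \<in> F \<Longrightarrow> a i * a j = a j * a i"
    and r: "\<And>i. i \<in> F \<Longrightarrow> spectral_radius (a i) < c i"
    and q: "\<And>i. i \<in> F \<Longrightarrow> quotient_norm (ideal_coset I (a i)) \<le> c i"
  obtains e f where "e \<in> I" "quasi_inverse e f"
    "\<And>i. i \<in> F \<Longrightarrow> norm (a i + e * a i + (a i + e * a i) * f) \<le> c i"
proof -
  have c: "c i > 0" if "i \<in> F" for i using r[OF that] spectral_radius_nonneg[of "a i"] by linarith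
  define b where "b i = (1 / c i) *\<^sub>R Adjoin (a i) 0" for i
  let ?J = "(\<lambda>x. Adjoin x 0) ` I"
  obtain P where P: "P \<in> ?J" "positive_element P"
    "\<And>i. i \<in> F \<Longrightarrow> positive_element ((1 + P) - star (b i) * (1 + P) * b i)"
  proof (rule simultaneous_contraction_weight[of ?J F b])
    show "closed_two_sided_ideal ?J" by (rule closed_two_sided_ideal_with_unit[OF I])
    show "finite F" by fact
    show "summable (\<lambda>n. (norm (b i ^ n))\<^sup>2)" if "i \<in> F" for i
      unfolding b_def using r[OF that] by (rule summable_of_spectral_radius_less)
    show "b i * b j = b j * b i" if "i \<in> F" "j \<in> F" for i j
      using comm[OF that] by (simp add: b_def with_unit_eq_iff mult.commute)
    show "\<exists>x\<in>?J. norm (b i + x) \<le> 1 + \<epsilon>" if i: "i \<in> F" and \<epsilon>: "\<epsilon> > 0" for i \<epsilon>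
    proof -
      have "quotient_norm (ideal_coset I (a i)) < c i * (1 + \<epsilon>)"
        using q[OF i] mult_pos_pos[OF c[OF i] \<epsilon>] by (simp add: distrib_left)
      then obtain x where x: "x \<in> I" "norm (a i + x) < c i * (1 + \<epsilon>)"
        using quotient_norm_less[OF I] by blast
      have "b i + Adjoin ((1 / c i) *\<^sub>R x) 0 = Adjoin ((1 / c i) *\<^sub>R (a i + x)) 0"
        by (simp add: b_def with_unit_eq_iff scaleR_add_right)
      then have "norm (b i + Adjoin ((1 / c i) *\<^sub>R x) 0) = norm (a i + x) / c i"
        using c[OF i] by simp
      also have "\<dots> \<le> 1 + \<epsilon>" using x c[OF i] by (simp add: field_simps)
      finally show ?thesis using ideal_scaleR[OF I x(1)] by blast
    qed
  qed blast
  obtain p where p: "p \<in> I" "P = Adjoin p 0" using P(1) by blast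
  obtain e f where ef: "e \<in> I" "quasi_inverse e f" "star (1 + Adjoin e 0) = 1 + Adjoin e 0"
    "(1 + Adjoin e 0) * (1 + Adjoin e 0) = 1 + Adjoin p 0"
    using sqrt_one_plus_ideal[OF I p(1)] P(2) p(2) by blast
  show ?thesis
  proof (rule that[OF ef(1,2)])
    fix i assume i: "i \<in> F"
    let ?y = "a i + e * a i + (a i + e * a i) * f"
    have "norm ((1 + Adjoin e 0) * b i * (1 + Adjoin f 0)) \<le> 1"
      using ef(2) P(3)[OF i]
      by (intro norm_conjugate_le_one) (simp_all only: ef(3,4) p(2) quasi_inverse_iff_with_unit)
    also have "(1 + Adjoin e 0) * b i * (1 + Adjoin f 0) = (1 / c i) *\<^sub>R Adjoin ?y 0"
      unfolding conjugate_with_unit b_def by (simp only: mult_scaleR_left mult_scaleR_right)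
    finally show "norm ?y \<le> c i" using c[OF i] by (simp add: field_simps)
  qed
qed

text \<open>
  The quasi-inverse \<open>f = - e - e f\<close> of an element of \<open>I\<close> is again in \<open>I\<close>, so conjugation by \<open>1 + e\<close> does
  not change the class modulo \<open>I\<close>.
\<close>

lemma conjugate_lower_bound:
  assumes I: "closed_two_sided_ideal I" and e: "e \<in> I" and ef: "quasi_inverse e f"
  shows "max (spectral_radius x) (quotient_norm (ideal_coset I x)) \<le> unitization_norm (conjugate_by e x)"
proof -
  have "f = - e - e * f" using ef by (simp add: quasi_inverse_def algebra_simps eq_neg_iff_add_eq_0)
  also have "\<dots> = (-1) *\<^sub>C e + (-1) *\<^sub>C (e * f)" by (simp add: scaleC_minus_one)
  also have "\<dots> \<in> I" by (intro ideal_add ideal_scaleC ideal_mult_right I e)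
  finally have "f \<in> I" .
  then have "e * x + (x + e * x) * f \<in> I"
    using I e by (simp add: ideal_add ideal_mult_left ideal_mult_right)
  then have "quotient_norm (ideal_coset I x) \<le> norm (x + (e * x + (x + e * x) * f))"
    by (rule quotient_norm_le[OF I])
  then show ?thesis
    using spectral_radius_le_conjugate[OF ef, of x]
    by (simp add: conjugate_by_eq[OF ef] unitization_norm_embed add.assoc)
qed

theorem theorem1:
  fixes I :: "'a::cstar_algebra set" and a :: "nat \<Rightarrow> 'a" and n :: nat
  assumes "closed_two_sided_ideal I"
    and "\<And>i j. i \<in> {1..n} \<Longrightarrow> j \<in> {1..n} \<Longrightarrow> a i * a j = a j * a i"
  shows
    "(\<forall>\<epsilon>>0. \<exists>e\<in>I. one_plus e \<in> Units unitization \<and>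
       (\<forall>j\<in>{1..n}.
          unitization_norm (conjugate_by e (a j)) - \<epsilon>
            \<le> max (spectral_radius (a j)) (quotient_norm (ideal_coset I (a j))) \<and>
          max (spectral_radius (a j)) (quotient_norm (ideal_coset I (a j)))
            \<le> unitization_norm (conjugate_by e (a j))))
     \<and>
     ((\<forall>j\<in>{1..n}. spectral_radius (a j) < quotient_norm (ideal_coset I (a j))) \<longrightarrow>
       (\<exists>e\<in>I. one_plus e \<in> Units unitization \<and>
         (\<forall>j\<in>{1..n}.
            max (spectral_radius (a j)) (quotient_norm (ideal_coset I (a j)))
              = unitization_norm (conjugate_by e (a j)))))"
proof -
  let ?M = "\<lambda>j. max (spectral_radius (a j)) (quotient_norm (ideal_coset I (a j)))"
  have upper: "\<exists>e\<in>I. one_plus e \<in> Units unitization \<and>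
      (\<forall>j\<in>{1..n}. unitization_norm (conjugate_by e (a j)) \<le> c j \<and>
        ?M j \<le> unitization_norm (conjugate_by e (a j)))"
    if c: "\<And>j. j \<in> {1..n} \<Longrightarrow> spectral_radius (a j) < c j"
      "\<And>j. j \<in> {1..n} \<Longrightarrow> quotient_norm (ideal_coset I (a j)) \<le> c j" for c
  proof -
    obtain e f where ef: "e \<in> I" "quasi_inverse e f"
      "\<And>j. j \<in> {1..n} \<Longrightarrow> norm (a j + e * a j + (a j + e * a j) * f) \<le> c j"
      using simultaneous_conjugation[of I "{1..n}" a c] assms c by auto
    then show ?thesis
      using conjugate_lower_bound[OF assms(1) ef(1,2)] one_plus_Units
      by (intro bexI[of _ e]) (auto simp: conjugate_by_eq[OF ef(2)] unitization_norm_embed)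
  qed
  show ?thesis
  proof (intro conjI allI impI)
    fix \<epsilon> :: real assume "\<epsilon> > 0"
    then show "\<exists>e\<in>I. one_plus e \<in> Units unitization \<and>
       (\<forall>j\<in>{1..n}. unitization_norm (conjugate_by e (a j)) - \<epsilon> \<le> ?M j \<and>
          ?M j \<le> unitization_norm (conjugate_by e (a j)))"
      using upper[of "\<lambda>j. ?M j + \<epsilon>"] by (simp add: diff_le_eq)
  next
    assume lt: "\<forall>j\<in>{1..n}. spectral_radius (a j) < quotient_norm (ideal_coset I (a j))"
    then have "?M j = quotient_norm (ideal_coset I (a j))" if "j \<in> {1..n}" for j
      using that by (simp add: max_def less_imp_le)
    then show "\<exists>e\<in>I. one_plus e \<in> Units unitization \<and>
         (\<forall>j\<in>{1..n}. ?M j = unitization_norm (conjugate_by e (a j)))"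
      using upper[of "\<lambda>j. quotient_norm (ideal_coset I (a j))"] lt by (metis order_antisym order_refl)
  qed
qed

end
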